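(* Let $Q=Q^t\in\mathbb{R}^{2d\times2d}$, $L\in\mathrm{GL}(2d,\mathbb{R})$, $U\in\mathrm{U}(2d,\mathbb{C})$, let $\mathbf{A}=\mathcal{V}_Q\mathcal{D}_L\mathcal{R}_U\in\mathrm{Sp}(4d,\mathbb{R})$, and assume that $U^tU$ is not $d\times d$ block-diagonal. Let $\Omega=\Omega(\mathbf{A})\in\mathrm{GL}(2d,\mathbb{R})$ be a matrix which, together with some index $1\le k\le d$ and some symplectic matrices $\mathcal{A},\mathcal{B}\in\mathrm{Sp}(2d,\mathbb{R})$, gives the factorization $$|W_{\mathbf{A}}(u,v)| = |\widehat{\mathcal{D}_\Omega}\, V^k_{\widehat{\mathcal{B}} v}\,\widehat{\mathcal{A}}u| \quad\text{for all } u,v\in L^2(\mathbb{R}^d).$$ If $f,g\in L^2(\mathbb{R}^d)$ satisfy $$|W_{\mathbf{A}}(f,g)(\lambda)|\le c\, e^{-\pi\alpha\|\Omega^{-1}\lambda\|^2/2}\quad\text{for a.a. }\lambda\in\mathbb{R}^{2d}$$ for some $c>0$ and $\alpha>1$, then $f\equiv0$ or $g\equiv0$.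
   Context: Functions in $L^2$ are identified when equal a.e. ($f\equiv0$ means zero a.e.). $\|\cdot\|$ is the Euclidean norm. $\mathrm{Sp}(2n,\mathbb{R})=\{M\in\mathbb{R}^{2n\times 2n}: M^t\mathcal{J}M=\mathcal{J}\}$, $\mathcal{J}=\begin{pmatrix}0&I\\-I&0\end{pmatrix}$. For $(x,\omega)\in\mathbb{R}^n\times\mathbb{R}^n$, $\rho(x,\omega)f(t)=e^{-\pi i x\cdot\omega}e^{2\pi i\omega\cdot t}f(t-x)$. For $M\in\mathrm{Sp}(2n,\mathbb{R})$, $\widehat{M}$ denotes an associated metaplectic operator: a unitary operator on $L^2(\mathbb{R}^n)$ with $\rho(M\lambda)=\widehat M\rho(\lambda)\widehat M^{-1}$ for all $\lambda\in\mathbb{R}^{2n}$; it is unique up to a factor of modulus 1 (irrelevant here, since only absolute values occur). Elementary symplectic matrices: for $Q=Q^t\in\mathbb{R}^{n\times n}$, $L\in\mathrm{GL}(n,\mathbb{R})$, $U=A+iB\in\mathrm{U}(n,\mathbb{C})$ ($A,B$ real), $$\mathcal{V}_Q=\begin{pmatrix}I&0\\Q&I\end{pmatrix},\quad \mathcal{D}_L=\begin{pmatrix}L&0\\0&L^{-t}\end{pmatrix},\quad \mathcal{R}_U=\begin{pmatrix}A&B\\-B&A\end{pmatrix}.$$ One takes $\widehat{\mathcal{D}_L}F(x)=|\det L|^{-1/2}F(L^{-1}x)$. For $\mathbf{A}\in\mathrm{Sp}(4d,\mathbb{R})$, $\widehat{\mathbf{A}}$ acts on $L^2(\mathbb{R}^{2d})$,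 and the metaplectic time-frequency representation is $W_{\mathbf{A}}(f,g)=\widehat{\mathbf{A}}(f\otimes\overline g)$ for $f,g\in L^2(\mathbb{R}^d)$, where $(f\otimes \overline g)(x,y)=f(x)\overline{g(y)}$. A $2d\times2d$ matrix is called $d\times d$ block-diagonal if it has the form $\begin{pmatrix}U_1&0\\0&U_2\end{pmatrix}$ with $U_1,U_2$ of size $d\times d$. $U^t$ is the transpose (no conjugation). Partial short-time Fourier transform: for $1\le k\le d$ and $f,g\in L^2(\mathbb{R}^d)$, $$V^k_gf(x_1,x_2,\omega_1,\omega_2)=\int_{\mathbb{R}^k}f(t,x_2)\overline{g(t-x_1,-\omega_2)}e^{-2\pi i t\cdot\omega_1}\,dt,$$ for $(x_1,x_2,\omega_1,\omega_2)\in\mathbb{R}^k\times\mathbb{R}^{d-k}\times\mathbb{R}^k\times\mathbb{R}^{d-k}$ (defined for almost all $(x_2,\omega_2)$); for $k=d$ this is the usual short-time Fourier transform. It is known that when $U^tU$ is not $d\times d$ block-diagonal, data $k,\mathcal{A},\mathcal{B},\Omega$ giving the factorization in the claim exist. *)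

theory Defs
  imports "HOL-Analysis.Analysis"
begin

(* The phase space \<real>\<^sup>n \<times> \<real>\<^sup>n = \<real>\<^sup>2\<^sup>n is real ^ ('n + 'n): the coordinates with index Inl i form the
   first component, those with index Inr i the second one. *)

definition fst_part :: "'a ^ ('n::finite + 'm::finite) \<Rightarrow> 'a ^ 'n" where
  "fst_part z = (\<chi> i. z $ Inl i)"

definition snd_part :: "'a ^ ('n::finite + 'm::finite) \<Rightarrow> 'a ^ 'm" where
  "snd_part z = (\<chi> i. z $ Inr i)"

definition block_mat ::
  "'a ^ 'n::finite ^ 'n \<Rightarrow> 'a ^ 'm::finite ^ 'n \<Rightarrow> 'a ^ 'n ^ 'm \<Rightarrow> 'a ^ 'm ^ 'm \<Rightarrow> 'a ^ ('n + 'm) ^ ('n + 'm)" where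
  "block_mat A B C D =
     (\<chi> i j. case i of
        Inl a \<Rightarrow> (case j of Inl b \<Rightarrow> A $ a $ b | Inr b \<Rightarrow> B $ a $ b)
      | Inr a \<Rightarrow> (case j of Inl b \<Rightarrow> C $ a $ b | Inr b \<Rightarrow> D $ a $ b))"

definition block_diagonal :: "'a::zero ^ ('n::finite + 'n) ^ ('n + 'n) \<Rightarrow> bool" where
  "block_diagonal M \<longleftrightarrow> (\<exists>U\<^sub>1 U\<^sub>2. M = block_mat U\<^sub>1 0 0 U\<^sub>2)"

definition symplectic_J :: "real ^ ('n::finite + 'n) ^ ('n + 'n)" where
  "symplectic_J = block_mat 0 (mat 1) (- mat 1) 0"

definition symplectic :: "real ^ ('n::finite + 'n) ^ ('n + 'n) \<Rightarrow> bool" where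
  "symplectic M \<longleftrightarrow> transpose M ** symplectic_J ** M = symplectic_J"

definition unitary_matrix :: "complex ^ 'n::finite ^ 'n \<Rightarrow> bool" where
  "unitary_matrix U \<longleftrightarrow>
     (let U' = (\<chi> i j. cnj (U $ j $ i)) in U' ** U = mat 1 \<and> U ** U' = mat 1)"

definition sympl_V :: "real ^ 'n::finite ^ 'n \<Rightarrow> real ^ ('n + 'n) ^ ('n + 'n)" where
  "sympl_V Q = block_mat (mat 1) 0 Q (mat 1)"

definition sympl_D :: "real ^ 'n::finite ^ 'n \<Rightarrow> real ^ ('n + 'n) ^ ('n + 'n)" where
  "sympl_D L = block_mat L 0 0 (transpose (matrix_inv L))"

definition sympl_R :: "complex ^ 'n::finite ^ 'n \<Rightarrow> real ^ ('n + 'n) ^ ('n + 'n)" where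
  "sympl_R U =
     (let A = (\<chi> i j. Re (U $ i $ j)); B = (\<chi> i j. Im (U $ i $ j))
      in block_mat A B (- B) A)"

(* Elements of L\<^sup>2 are represented by functions; identities between them are almost-everywhere
   identities. *)

definition L2 :: "(real ^ 'n::finite \<Rightarrow> complex) set" where
  "L2 = {f \<in> borel_measurable lebesgue. integrable lebesgue (\<lambda>x. (cmod (f x))\<^sup>2)}"

definition ae_eq :: "(real ^ 'n::finite \<Rightarrow> complex) \<Rightarrow> (real ^ 'n \<Rightarrow> complex) \<Rightarrow> bool"
    (infix \<open>=\<^sub>a\<^sub>e\<close> 50) where
  "f =\<^sub>a\<^sub>e g \<longleftrightarrow> (AE x in lebesgue. f x = g x)"

definition L2_inner :: "(real ^ 'n::finite \<Rightarrow> complex) \<Rightarrow> (real ^ 'n \<Rightarrow> complex) \<Rightarrow> complex" where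
  "L2_inner f g = (LINT x|lebesgue. f x * cnj (g x))"

(* The first condition says that T acts on almost-everywhere classes. *)
definition unitary_op :: "((real ^ 'n::finite \<Rightarrow> complex) \<Rightarrow> (real ^ 'n \<Rightarrow> complex)) \<Rightarrow> bool" where
  "unitary_op T \<longleftrightarrow>
     (\<forall>f\<in>L2. \<forall>g\<in>L2. f =\<^sub>a\<^sub>e g \<longrightarrow> T f =\<^sub>a\<^sub>e T g) \<and>
     (\<forall>f\<in>L2. T f \<in> L2) \<and>
     (\<forall>f\<in>L2. \<forall>g\<in>L2. \<forall>a b. T (\<lambda>x. a * f x + b * g x) =\<^sub>a\<^sub>e (\<lambda>x. a * T f x + b * T g x)) \<and>
     (\<forall>f\<in>L2. \<forall>g\<in>L2. L2_inner (T f) (T g) = L2_inner f g) \<and>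
     (\<forall>h\<in>L2. \<exists>f\<in>L2. T f =\<^sub>a\<^sub>e h)"

definition tf_shift :: "real ^ ('n::finite + 'n) \<Rightarrow> (real ^ 'n \<Rightarrow> complex) \<Rightarrow> real ^ 'n \<Rightarrow> complex" where
  "tf_shift l f t =
     (let x = fst_part l; \<omega> = snd_part l
      in exp (- (\<i> * of_real (pi * (x \<bullet> \<omega>)))) * exp (\<i> * of_real (2 * pi * (\<omega> \<bullet> t))) * f (t - x))"

(* T is one of the metaplectic operators associated with M, which are determined up to a factor of
   modulus 1. In \<rho>(M\<lambda>) h = T \<rho>(\<lambda>) T\<^sup>-\<^sup>1 h, the function f is (a representative of) T\<^sup>-\<^sup>1 h. *)
definition metaplectic ::
  "real ^ ('n::finite + 'n) ^ ('n + 'n) \<Rightarrow> ((real ^ 'n \<Rightarrow> complex) \<Rightarrow> (real ^ 'n \<Rightarrow> complex)) \<Rightarrow> bool" where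
  "metaplectic M T \<longleftrightarrow> unitary_op T \<and>
     (\<forall>l. \<forall>h\<in>L2. \<forall>f\<in>L2. T f =\<^sub>a\<^sub>e h \<longrightarrow> tf_shift (M *v l) h =\<^sub>a\<^sub>e T (tf_shift l f))"

definition dilation_op :: "real ^ 'n::finite ^ 'n \<Rightarrow> (real ^ 'n \<Rightarrow> complex) \<Rightarrow> real ^ 'n \<Rightarrow> complex" where
  "dilation_op L F x = of_real (\<bar>det L\<bar> powr (- 1 / 2)) * F (matrix_inv L *v x)"

definition tensor_cnj ::
  "(real ^ 'd::finite \<Rightarrow> complex) \<Rightarrow> (real ^ 'd \<Rightarrow> complex) \<Rightarrow> real ^ ('d + 'd) \<Rightarrow> complex" where
  "tensor_cnj f g z = f (fst_part z) * cnj (g (snd_part z))"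

(* metaplectic_tfr T f g is the metaplectic time-frequency representation W\<^sub>A(f, g) when metaplectic A T. *)
definition metaplectic_tfr ::
  "((real ^ ('d::finite + 'd) \<Rightarrow> complex) \<Rightarrow> (real ^ ('d + 'd) \<Rightarrow> complex))
   \<Rightarrow> (real ^ 'd \<Rightarrow> complex) \<Rightarrow> (real ^ 'd \<Rightarrow> complex) \<Rightarrow> real ^ ('d + 'd) \<Rightarrow> complex" where
  "metaplectic_tfr T f g = T (tensor_cnj f g)"

(* The index type 'd is linearly ordered only in order to make sense of its first k elements. *)
definition first_coords :: "nat \<Rightarrow> 'd::{finite,linorder} set" where
  "first_coords k = {i. card {j. j < i} < k}"

(* A point z = (x\<^sub>1, x\<^sub>2, \<omega>\<^sub>1, \<omega>\<^sub>2) of \<real>\<^sup>k \<times> \<real>\<^sup>d\<^sup>-\<^sup>k \<times> \<real>\<^sup>k \<times> \<real>\<^sup>d\<^sup>-\<^sup>k is given by x = (x\<^sub>1, x\<^sub>2) and \<omega> = (\<omega>\<^sub>1, \<omega>\<^sub>2)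
   in \<real>\<^sup>d. The variable of integration t ranges over the functions on the first k coordinates,
   with Lebesgue measure on \<real>\<^sup>k obtained as the completion of the product measure (sections of a
   Lebesgue measurable function need not be Borel measurable). *)
definition partial_stft ::
  "nat \<Rightarrow> (real ^ 'd::{finite,linorder} \<Rightarrow> complex)
   \<Rightarrow> (real ^ 'd::{finite,linorder} \<Rightarrow> complex) \<Rightarrow> real ^ ('d + 'd) \<Rightarrow> complex" where
  "partial_stft k g f z =
     (let x = fst_part z; \<omega> = snd_part z; K = first_coords k in
      LINT t|completion (\<Pi>\<^sub>M i\<in>K. lborel).
        f (\<chi> i. if i \<in> K then t i else x $ i)
        * cnj (g (\<chi> i. if i \<in> K then t i - x $ i else - \<omega> $ i))
        * exp (- (\<i> * of_real (2 * pi * (\<Sum>i\<in>K. t i * \<omega> $ i)))))"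

end

theory Submission
  imports Defs "HOL-Probability.Levy" "HOL-Complex_Analysis.Conformal_Mappings"
begin

text \<open>For \<open>F = T\<^sub>\<A> f\<close> and \<open>G = T\<^sub>\<B> g\<close> the factorization and the linear change of variables given by \<open>\<Omega>\<close> turn the
hypothesis into Gaussian decay, with the rate \<open>pi * \<alpha> / 2\<close>, of the partial short-time Fourier transform of \<open>F\<close> with
the window \<open>G\<close>. Metaplectic operators are isometries of \<open>L\<^sup>2\<close>, so it suffices to show that \<open>F\<close> or \<open>G\<close> is null. When
the coordinates outside the first \<open>k\<close> are frozen, the partial transform becomes the ordinary short-time Fourier
transform of slices of \<open>F\<close> and \<open>G\<close>; by Fubini's theorem everything reduces to an uncertainty principle for the
short-time Fourier transform on \<open>\<real>\<^sup>k\<close> (\<open>stft_hardy\<close>).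

For the latter, let \<open>V (x, \<omega>)\<close> be the transform of \<open>f\<close> with the window \<open>g\<close>, and put \<open>h t = f t * cnj (g (t - x))\<close>
for a fixed \<open>x\<close>. The Fourier transform of \<open>h\<close> is \<open>V (x, \<cdot>)\<close>. Two conclusions are drawn from its Gaussian decay by
Fourier inversion (\<open>fourier_on_inversion\<close>). First, \<open>h\<close> extends to an entire function of each coordinate, which
grows at most like \<open>exp (2 * pi / \<alpha> * v\<^sup>2)\<close> when the imaginary part is \<open>v\<close>. Second, letting \<open>x\<close> vary, \<open>f t * g s\<close> is
bounded by a multiple of \<open>exp (- (pi * \<alpha> / 2) * \<bar>t - s\<bar>\<^sup>2)\<close>. Regrouping the four factors of \<open>h t * h s\<close> as
\<open>f t * g (s - x)\<close> and \<open>f s * g (t - x)\<close> shows that this product is bounded by a multiple of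
\<open>exp (- (pi * \<alpha>) * \<bar>t - s\<bar>\<^sup>2)\<close>. (In the formal statements \<open>\<bar>t - s\<bar>\<close> is the distance in one chosen coordinate.)

Now consider \<open>w \<mapsto> h (\<sigma> + w) * h (\<sigma> - w)\<close> for a complex number \<open>w\<close> acting on that coordinate. It grows at most like
\<open>exp (4 * pi / \<alpha> * v\<^sup>2)\<close>, and on the real line it decays like \<open>exp (- 4 * pi * \<alpha> * w\<^sup>2)\<close>. Since \<open>1 / \<alpha> < \<alpha>\<close>, a
Phragmen-Lindelof argument (\<open>gaussian_growth_decay_imp_zero\<close>) shows that it vanishes; its value at 0 is
\<open>(h \<sigma>)\<^sup>2\<close>. Thus \<open>h = 0\<close> for almost all \<open>x\<close>, which means that \<open>f\<close> or \<open>g\<close> is null.\<close>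

section \<open>Entire functions with Gaussian growth and decay\<close>

text \<open>The substitution \<open>z = exp \<zeta>\<close> turns the sector \<open>0 \<le> arg z \<le> \<theta>\<close> into a horizontal strip, and growth of
order 2 in \<open>z\<close> into growth \<open>exp (D * exp (2 * x))\<close>. The opening \<open>\<theta>\<close> is smaller than \<open>pi / 2\<close>, so there is an
order \<open>\<rho> > 2\<close> for which \<open>exp (- \<epsilon> z^\<rho>)\<close>, rotated to be symmetric about the axis of the sector, still decays
in the whole sector; multiplying by it makes the maximum modulus principle applicable. In the strip this
multiplier is an entire function, and the vertex of the sector lies at \<open>- \<infinity>\<close>, where the growth bound tends
to \<open>C\<close>.\<close>

lemma phragmen_lindelof_strip:
  fixes F :: "complex \<Rightarrow> complex" and C D \<theta> :: real
  assumes hol: "F holomorphic_on UNIV" and \<theta>: "0 < \<theta>" "\<theta> < pi / 2" and "C > 0" "D \<ge> 0"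
    and growth: "\<And>x y. 0 \<le> y \<Longrightarrow> y \<le> \<theta> \<Longrightarrow> cmod (F (Complex x y)) \<le> C * exp (D * exp (2 * x))"
    and lower: "\<And>x. cmod (F (Complex x 0)) \<le> C" and upper: "\<And>x. cmod (F (Complex x \<theta>)) \<le> C"
    and y: "0 \<le> y" "y \<le> \<theta>"
  shows "cmod (F (Complex x y)) \<le> C"
proof -
  \<comment> \<open>halfway between the order 2 of the growth and the critical order \<open>pi / \<theta>\<close> of the strip\<close>
  define \<rho> where "\<rho> = 1 + pi / (2 * \<theta>)"
  have \<rho>: "2 < \<rho>" "\<rho> * \<theta> / 2 < pi / 2" "0 < \<rho> * \<theta>"
  proof -
    have "\<rho> * \<theta> = \<theta> + pi / 2" using \<theta> by (simp add: \<rho>_def field_simps)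
    then show "\<rho> * \<theta> / 2 < pi / 2" "0 < \<rho> * \<theta>" using \<theta> by auto
    show "2 < \<rho>" using \<theta> by (simp add: \<rho>_def field_simps)
  qed
  define \<kappa> where "\<kappa> = cos (\<rho> * \<theta> / 2)"
  have \<kappa>: "0 < \<kappa>" using \<rho> unfolding \<kappa>_def by (intro cos_gt_zero) auto
  have cos_ge: "\<kappa> \<le> cos (\<rho> * (v - \<theta> / 2))" if "0 \<le> v" "v \<le> \<theta>" for v
  proof -
    have "\<bar>\<rho> * (v - \<theta> / 2)\<bar> \<le> \<rho> * \<theta> / 2"
      using that \<rho>(1) by (auto simp: abs_mult abs_if field_simps)
    then have "cos (\<rho> * \<theta> / 2) \<le> cos \<bar>\<rho> * (v - \<theta> / 2)\<bar>"
      using \<rho> by (intro cos_monotone_0_pi_le) auto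
    then show ?thesis unfolding \<kappa>_def by simp
  qed
  define G where "G \<epsilon> z = F z * exp (- of_real \<epsilon> * exp (of_real \<rho> * (z - \<i> * of_real (\<theta> / 2))))" for \<epsilon> z
  have normG: "cmod (G \<epsilon> (Complex u v))
      = cmod (F (Complex u v)) * exp (- \<epsilon> * (exp (\<rho> * u) * cos (\<rho> * (v - \<theta> / 2))))" for \<epsilon> u v
    by (simp add: G_def norm_mult Re_exp)
  have normG_le: "cmod (G \<epsilon> (Complex u v)) \<le> cmod (F (Complex u v)) * exp (- (\<epsilon> * \<kappa> * exp (\<rho> * u)))"
    if "0 \<le> v" "v \<le> \<theta>" "0 < \<epsilon>" for \<epsilon> u v
  proof -
    have "\<epsilon> * \<kappa> * exp (\<rho> * u) \<le> \<epsilon> * (exp (\<rho> * u) * cos (\<rho> * (v - \<theta> / 2)))"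
      using cos_ge[OF that(1,2)] that(3) by (simp add: mult.assoc mult.commute)
    then show ?thesis unfolding normG by (intro mult_left_mono) auto
  qed
  have normG_le': "cmod (G \<epsilon> (Complex u v)) \<le> cmod (F (Complex u v))"
    if "0 \<le> v" "v \<le> \<theta>" "0 < \<epsilon>" for \<epsilon> u v
  proof -
    have "cmod (F (Complex u v)) * exp (- (\<epsilon> * \<kappa> * exp (\<rho> * u))) \<le> cmod (F (Complex u v)) * 1"
      using that \<kappa> by (intro mult_left_mono) auto
    then show ?thesis using normG_le[OF that, of u] by linarith
  qed
  have G_le: "cmod (G \<epsilon> (Complex x y)) \<le> C" if \<epsilon>: "0 < \<epsilon>" for \<epsilon>
  proof -
    have "eventually (\<lambda>X. D * exp (2 * X) \<le> \<epsilon> * \<kappa> * exp (\<rho> * X)) at_top"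
    proof -
      have "filterlim (\<lambda>X. exp ((\<rho> - 2) * X)) at_top at_top"
        using \<rho>(1) by (intro filterlim_compose[OF exp_at_top]
            filterlim_tendsto_pos_mult_at_top[OF tendsto_const] filterlim_ident) auto
      then have "eventually (\<lambda>X. D / (\<epsilon> * \<kappa>) \<le> exp ((\<rho> - 2) * X)) at_top"
        by (simp add: filterlim_at_top)
      then show ?thesis
      proof eventually_elim
        case (elim X)
        then have "D \<le> \<epsilon> * \<kappa> * exp ((\<rho> - 2) * X)" using \<epsilon> \<kappa> by (simp add: field_simps)
        then have "D * exp (2 * X) \<le> (\<epsilon> * \<kappa> * exp ((\<rho> - 2) * X)) * exp (2 * X)" by simp
        also have "\<dots> = \<epsilon> * \<kappa> * exp (\<rho> * X)"
          by (simp add: exp_add[symmetric] algebra_simps)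
        finally show ?case .
      qed
    qed
    then have ev: "eventually (\<lambda>X. cmod (G \<epsilon> (Complex x y)) \<le> C * exp (D * exp (- 2 * X))) at_top"
      using eventually_ge_at_top[of "\<bar>x\<bar>"]
    proof eventually_elim
      case (elim X)
      let ?S = "cbox (Complex (-X) 0) (Complex X \<theta>)"
      have C_le: "C \<le> C * exp (D * exp (- 2 * X))"
        using \<open>C > 0\<close> \<open>D \<ge> 0\<close> by simp
      show ?case
      proof (rule maximum_modulus_frontier[of "G \<epsilon>" ?S])
        have "G \<epsilon> holomorphic_on UNIV"
          unfolding G_def by (intro holomorphic_intros hol)
        then show "G \<epsilon> holomorphic_on interior ?S" "continuous_on (closure ?S) (G \<epsilon>)"
          by (auto intro: holomorphic_on_subset continuous_on_subset[OF holomorphic_on_imp_continuous_on])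
        show "bounded ?S" by simp
        show "Complex x y \<in> ?S" using elim y by (auto simp: in_cbox_complex_iff)
      next
        fix z assume "z \<in> frontier ?S"
        then have "z \<in> ?S" "z \<notin> box (Complex (-X) 0) (Complex X \<theta>)"
          by (auto simp: frontier_def interior_cbox)
        then have z: "-X \<le> Re z" "Re z \<le> X" "0 \<le> Im z" "Im z \<le> \<theta>"
          and "Re z = -X \<or> Re z = X \<or> Im z = 0 \<or> Im z = \<theta>"
          by (auto simp: in_cbox_complex_iff in_box_complex_iff)
        from this(5) show "cmod (G \<epsilon> z) \<le> C * exp (D * exp (- 2 * X))"
        proof (elim disjE)
          assume "Re z = -X"
          then have "cmod (F z) \<le> C * exp (D * exp (- 2 * X))"
            using growth[of "Im z" "-X"] z by (metis complex_surj mult_minus_left mult_minus_right)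
          then show ?thesis using normG_le'[of "Im z" \<epsilon> "Re z"] z \<epsilon> by simp
        next
          assume X: "Re z = X"
          have "cmod (G \<epsilon> z) \<le> cmod (F z) * exp (- (\<epsilon> * \<kappa> * exp (\<rho> * X)))"
            using normG_le[of "Im z" \<epsilon> "Re z"] z \<epsilon> by (simp add: X[symmetric])
          also have "\<dots> \<le> (C * exp (D * exp (2 * X))) * exp (- (\<epsilon> * \<kappa> * exp (\<rho> * X)))"
            using growth[of "Im z" "X"] z X by (intro mult_right_mono) (metis complex_surj, simp)
          also have "\<dots> = C * exp (D * exp (2 * X) - \<epsilon> * \<kappa> * exp (\<rho> * X))"
            by (simp add: exp_diff exp_minus field_simps)
          also have "\<dots> \<le> C * 1"
            using elim \<open>C > 0\<close> by (intro mult_left_mono) auto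
          finally show ?thesis using C_le by simp
        next
          assume "Im z = 0"
          then have "cmod (F z) \<le> C" using lower[of "Re z"] by (metis complex_surj)
          then show ?thesis using normG_le'[of "Im z" \<epsilon> "Re z"] z \<epsilon> C_le by simp
        next
          assume "Im z = \<theta>"
          then have "cmod (F z) \<le> C" using upper[of "Re z"] by (metis complex_surj)
          then show ?thesis using normG_le'[of "Im z" \<epsilon> "Re z"] z \<epsilon> C_le by simp
        qed
      qed
    qed
    have "((\<lambda>X. C * exp (D * exp (- 2 * X))) \<longlongrightarrow> C * exp (D * 0)) at_top"
      by (intro tendsto_intros filterlim_compose[OF exp_at_bot]
          filterlim_tendsto_neg_mult_at_bot[OF tendsto_const] filterlim_ident) auto
    then show ?thesis
      using tendsto_lowerbound[OF _ ev] by simp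
  qed
  have "((\<lambda>\<epsilon>. cmod (G \<epsilon> (Complex x y))) \<longlongrightarrow> cmod (F (Complex x y)) *
      exp (- 0 * (exp (\<rho> * x) * cos (\<rho> * (y - \<theta> / 2))))) (at_right 0)"
    unfolding normG by (intro tendsto_intros)
  moreover have "eventually (\<lambda>\<epsilon>. cmod (G \<epsilon> (Complex x y)) \<le> C) (at_right 0)"
    using G_le by (simp add: eventually_at_right_less eventually_mono[OF eventually_at_right_less])
  ultimately show ?thesis
    using tendsto_upperbound by force
qed

text \<open>Consider the first quadrant. Writing \<open>z = r exp (\<i> y)\<close>, the function \<open>p z * exp ((B - \<i> N) z\<^sup>2)\<close> is bounded
on the positive real axis because of the decay of \<open>p\<close> there, and on the ray \<open>y = \<theta>\<close> as soon as
\<open>A sin\<^sup>2 \<theta> + B cos (2 \<theta>) + N sin (2 \<theta>) \<le> 0\<close>. At \<open>\<theta> = pi / 2\<close> the left-hand side is \<open>A - B < 0\<close>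
for every \<open>N\<close>, so a suitable \<open>\<theta> < pi / 2\<close> exists for each \<open>N\<close>, and it can be chosen beyond any given ray. By
Phragmen-Lindelof the product is bounded between the two rays, uniformly in \<open>N\<close>, and \<open>N \<rightarrow> \<infinity>\<close> forces \<open>p = 0\<close>
there. The strict inequality \<open>A < B\<close> is what makes this work: for \<open>A = B\<close> the function \<open>exp (- A z\<^sup>2)\<close>
would be a counterexample.\<close>

theorem gaussian_growth_decay_imp_zero:
  fixes p :: "complex \<Rightarrow> complex" and A B C :: real
  assumes hol: "p holomorphic_on UNIV" and AB: "0 \<le> A" "A < B"
    and growth: "\<And>z. cmod (p z) \<le> C * exp (A * (Im z)\<^sup>2)"
    and decay: "\<And>u::real. cmod (p (of_real u)) \<le> C * exp (- B * u\<^sup>2)"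
  shows "p z = 0"
proof -
  have "cmod (p 0) \<le> C" using growth[of 0] by simp
  then have "C \<ge> 0" by (meson norm_ge_zero order_trans)
  \<comment> \<open>the strip lemma wants a positive constant\<close>
  define C' where "C' = C + 1"
  have C': "C' > 0" using \<open>C \<ge> 0\<close> by (simp add: C'_def)
  have CC': "C * t \<le> C' * t" if "t \<ge> 0" for t using that by (simp add: C'_def algebra_simps)
  have ray: "p (exp (Complex x y)) = 0" if y: "0 < y" "y < pi / 2" for x y
  proof -
    have bound: "cmod (p (exp (Complex x y))) * exp (exp (2 * x) * (B * cos (2 * y))) *
        exp (N * (exp (2 * x) * sin (2 * y))) \<le> C'" if N: "N \<ge> 0" for N
    proof -
      have "((\<lambda>\<theta>. A * (sin \<theta>)\<^sup>2 + B * cos (2 * \<theta>) + N * sin (2 * \<theta>)) \<longlongrightarrow>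
          A * (sin (pi / 2))\<^sup>2 + B * cos (2 * (pi / 2)) + N * sin (2 * (pi / 2))) (at_left (pi / 2))"
        by (intro tendsto_intros)
      then have "((\<lambda>\<theta>. A * (sin \<theta>)\<^sup>2 + B * cos (2 * \<theta>) + N * sin (2 * \<theta>)) \<longlongrightarrow> A - B) (at_left (pi / 2))"
        by simp
      then have "eventually (\<lambda>\<theta>. A * (sin \<theta>)\<^sup>2 + B * cos (2 * \<theta>) + N * sin (2 * \<theta>) < 0) (at_left (pi / 2))"
        using AB by (intro order_tendstoD(2)) auto
      moreover have "eventually (\<lambda>\<theta>. \<theta> \<in> {y <..< pi / 2}) (at_left (pi / 2))"
        using y by (intro eventually_at_leftI) auto
      ultimately have "eventually (\<lambda>\<theta>. A * (sin \<theta>)\<^sup>2 + B * cos (2 * \<theta>) + N * sin (2 * \<theta>) < 0 \<and>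
          \<theta> \<in> {y <..< pi / 2}) (at_left (pi / 2))"
        by (rule eventually_conj)
      then obtain \<theta> where \<theta>: "A * (sin \<theta>)\<^sup>2 + B * cos (2 * \<theta>) + N * sin (2 * \<theta>) < 0" "y < \<theta>" "\<theta> < pi / 2"
        using eventually_happens[of _ "at_left (pi / 2 :: real)"] by auto
      define F where "F z = p (exp z) * exp (Complex B (- N) * exp (2 * z))" for z
      have normF: "cmod (F (Complex u v)) = cmod (p (exp (Complex u v))) *
          exp (exp (2 * u) * (B * cos (2 * v) + N * sin (2 * v)))" for u v
        by (simp add: F_def norm_mult Re_exp Im_exp algebra_simps)
      have p_le: "cmod (p (exp (Complex u v))) \<le> C * exp (exp (2 * u) * (A * (sin v)\<^sup>2))" for u v
      proof -
        have "A * (Im (exp (Complex u v)))\<^sup>2 = exp (2 * u) * (A * (sin v)\<^sup>2)"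
          unfolding exp_double by (simp add: Im_exp power_mult_distrib)
        then show ?thesis using growth[of "exp (Complex u v)"] by (simp only:)
      qed
      have "cmod (F (Complex x y)) \<le> C'"
      proof (rule phragmen_lindelof_strip[of F \<theta> C' "A + B + N"])
        have "(\<lambda>z. p (exp z)) holomorphic_on UNIV"
          using holomorphic_on_compose_gen[OF holomorphic_on_exp hol, of UNIV] by (simp add: o_def)
        then show "F holomorphic_on UNIV" unfolding F_def by (intro holomorphic_intros)
        show "0 < \<theta>" "\<theta> < pi / 2" "0 \<le> y" "y \<le> \<theta>" "0 < C'" using \<theta> y C' by auto
        show "0 \<le> A + B + N" using AB N by auto
      next
        fix u v
        have "A * (sin v)\<^sup>2 \<le> A * 1" using AB by (intro mult_left_mono) (auto simp: abs_square_le_1)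
        moreover have "B * cos (2 * v) \<le> B * 1" "N * sin (2 * v) \<le> N * 1"
          using AB N by (intro mult_left_mono; simp)+
        ultimately have *: "A * (sin v)\<^sup>2 + (B * cos (2 * v) + N * sin (2 * v)) \<le> A + B + N" by simp
        have "cmod (F (Complex u v)) \<le> C * exp (exp (2 * u) * (A * (sin v)\<^sup>2)) *
            exp (exp (2 * u) * (B * cos (2 * v) + N * sin (2 * v)))"
          unfolding normF by (intro mult_right_mono p_le) auto
        also have "\<dots> = C * exp (exp (2 * u) * (A * (sin v)\<^sup>2 + (B * cos (2 * v) + N * sin (2 * v))))"
          by (simp add: exp_add algebra_simps)
        also have "\<dots> \<le> C * exp (exp (2 * u) * (A + B + N))"
          using * \<open>C \<ge> 0\<close> by (intro mult_left_mono) auto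
        also have "\<dots> \<le> C' * exp ((A + B + N) * exp (2 * u))"
          using CC'[of "exp (exp (2 * u) * (A + B + N))"] by (simp add: mult.commute)
        finally show "cmod (F (Complex u v)) \<le> C' * exp ((A + B + N) * exp (2 * u))" .
      next
        fix u
        have "exp (Complex u 0) = of_real (exp u)" by (simp add: complex_eq_iff Re_exp Im_exp)
        then have "cmod (p (exp (Complex u 0))) \<le> C * exp (- B * (exp u)\<^sup>2)" using decay by simp
        then have "cmod (F (Complex u 0)) \<le> C * exp (- B * (exp u)\<^sup>2) * exp (exp (2 * u) * B)"
          unfolding normF by simp
        also have "\<dots> = C * exp (- B * (exp u)\<^sup>2 + exp (2 * u) * B)" by (simp only: exp_add mult.assoc)
        also have "- B * (exp u)\<^sup>2 + exp (2 * u) * B = 0" unfolding exp_double by algebra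
        also have "C * exp 0 = C" by simp
        finally show "cmod (F (Complex u 0)) \<le> C'" by (simp add: C'_def)
      next
        fix u
        have "cmod (F (Complex u \<theta>)) \<le> C * exp (exp (2 * u) * (A * (sin \<theta>)\<^sup>2)) *
            exp (exp (2 * u) * (B * cos (2 * \<theta>) + N * sin (2 * \<theta>)))"
          unfolding normF by (intro mult_right_mono p_le) auto
        also have "\<dots> = C * exp (exp (2 * u) * (A * (sin \<theta>)\<^sup>2 + B * cos (2 * \<theta>) + N * sin (2 * \<theta>)))"
          by (simp add: exp_add algebra_simps)
        also have "\<dots> \<le> C * 1"
          using \<theta>(1) \<open>C \<ge> 0\<close> by (intro mult_left_mono) (auto simp: mult_le_0_iff)
        finally show "cmod (F (Complex u \<theta>)) \<le> C'" by (simp add: C'_def)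
      qed
      then show ?thesis
        unfolding normF by (simp add: exp_add algebra_simps)
    qed
    show ?thesis
    proof (rule ccontr)
      assume nz: "p (exp (Complex x y)) \<noteq> 0"
      define a where "a = cmod (p (exp (Complex x y))) * exp (exp (2 * x) * (B * cos (2 * y)))"
      define b where "b = exp (2 * x) * sin (2 * y)"
      have a: "a > 0" using nz by (simp add: a_def)
      have b: "b > 0" using y by (simp add: b_def sin_gt_zero)
      have le: "a * exp (N * b) \<le> C'" if "N \<ge> 0" for N using bound[OF that] by (simp add: a_def b_def)
      have "a * (1 + (C' / a / b) * b) \<le> a * exp ((C' / a / b) * b)"
        using a by (intro mult_left_mono) auto
      also have "\<dots> \<le> C'" using a b C' by (intro le) auto
      finally show False using a b by (simp add: algebra_simps)
    qed
  qed
  have quad: "p w = 0" if "w \<in> {w. 0 < Re w} \<inter> {w. 0 < Im w}" for w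
  proof -
    have w: "w \<noteq> 0" "0 < Re w" "0 < Im w" using that by auto
    then have "0 < Im (Ln w)" "Im (Ln w) < pi / 2"
      using Im_Ln_pos_lt[OF w(1)] Re_Ln_pos_lt[OF w(1)] by auto
    then have "p (exp (Complex (Re (Ln w)) (Im (Ln w)))) = 0" by (rule ray)
    then show ?thesis using w(1) by (simp del: Re_Ln)
  qed
  show ?thesis
  proof (rule analytic_continuation_open[where s = "{w. 0 < Re w} \<inter> {w. 0 < Im w}" and s' = UNIV and f = p and g = "\<lambda>_. 0"])
    show "open ({w. 0 < Re w} \<inter> {w. 0 < Im w})"
      by (intro open_Int open_halfspace_Re_gt open_halfspace_Im_gt)
    have "Complex 1 1 \<in> {w. 0 < Re w} \<inter> {w. 0 < Im w}" by simp
    then show "{w. 0 < Re w} \<inter> {w. 0 < Im w} \<noteq> {}" by blast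
  qed (use hol quad in auto)
qed

section \<open>The Fourier transform on the real line\<close>

lemma integrable_gaussian:
  fixes a m :: real
  assumes "0 < a"
  shows "integrable lborel (\<lambda>x. exp (- a * (x - m)\<^sup>2))"
proof -
  define \<sigma> where "\<sigma> = sqrt (1 / (2 * a))"
  have \<sigma>: "\<sigma> > 0" "2 * \<sigma>\<^sup>2 = 1 / a" using assms by (auto simp: \<sigma>_def)
  have "integrable lborel (\<lambda>x. sqrt (2 * pi * \<sigma>\<^sup>2) * normal_density m \<sigma> x)"
    using \<sigma> by (intro integrable_mult_right integrable_normal_density)
  moreover have "sqrt (2 * pi * \<sigma>\<^sup>2) * normal_density m \<sigma> x = exp (- a * (x - m)\<^sup>2)" for x
    unfolding normal_density_def \<sigma>(2) using \<sigma>(1) by (simp add: field_simps)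
  ultimately show ?thesis by simp
qed

text \<open>This is the characteristic function of the normal distribution; the substitution \<open>x = u / sqrt (2 * pi)\<close>
leads to the normalization in which the Gaussian is its own Fourier transform.\<close>

lemma fourier_std_gaussian:
  "(LINT x|lborel. of_real (exp (- pi * x\<^sup>2)) * exp (\<i> * of_real (2 * pi * (x * y))))
    = complex_of_real (exp (- pi * y\<^sup>2))"
proof -
  define s where "s = sqrt (2 * pi)"
  have s: "s > 0" "s\<^sup>2 = 2 * pi" by (auto simp: s_def)
  have "complex_of_real (exp (- (s * y)\<^sup>2 / 2)) = char std_normal_distribution (s * y)"
    by (simp add: char_std_normal_distribution)
  also have "\<dots> = (CLINT x|lborel. std_normal_density x *\<^sub>R iexp (s * y * x))"
    unfolding char_def by (subst integral_density) auto
  also have "\<dots> = \<bar>s\<bar> *\<^sub>R (CLINT x|lborel. std_normal_density (0 + s * x) *\<^sub>R iexp (s * y * (0 + s * x)))"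
    using s by (intro lborel_integral_real_affine) auto
  also have "\<dots> = (CLINT x|lborel. s *\<^sub>R (std_normal_density (0 + s * x) *\<^sub>R iexp (s * y * (0 + s * x))))"
    unfolding abs_of_pos[OF s(1)] by (rule integral_scaleR_right[symmetric])
  also have "\<dots> = (LINT x|lborel. of_real (exp (- pi * x\<^sup>2)) * exp (\<i> * of_real (2 * pi * (x * y))))"
  proof (intro Bochner_Integration.integral_cong refl)
    fix x
    have "s * std_normal_density (0 + s * x) = exp (- pi * x\<^sup>2)"
      using s by (simp add: std_normal_density_def power_mult_distrib flip: s_def)
    moreover have "s * y * (0 + s * x) = s\<^sup>2 * (x * y)" by (simp add: power2_eq_square)
    then have "s * y * (0 + s * x) = 2 * pi * (x * y)" unfolding s by simp
    ultimately show "s *\<^sub>R (std_normal_density (0 + s * x) *\<^sub>R iexp (s * y * (0 + s * x)))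
        = of_real (exp (- pi * x\<^sup>2)) * exp (\<i> * of_real (2 * pi * (x * y)))"
      by (metis scaleR_conv_of_real scaleR_scaleR)
  qed
  finally show ?thesis using s by (simp add: power_mult_distrib)
qed

lemma fourier_shifted_gaussian:
  "(LINT x|lborel. of_real (exp (- pi * (x - m)\<^sup>2)) * exp (- (\<i> * of_real (2 * pi * (x * y)))))
    = complex_of_real (exp (- pi * y\<^sup>2)) * exp (- (\<i> * of_real (2 * pi * (m * y))))"
proof -
  have "(LINT x|lborel. of_real (exp (- pi * (x - m)\<^sup>2)) * exp (- (\<i> * of_real (2 * pi * (x * y)))))
    = \<bar>1\<bar> *\<^sub>R (LINT x|lborel. complex_of_real (exp (- pi * (m + 1 * x - m)\<^sup>2)) * exp (- (\<i> * of_real (2 * pi * ((m + 1 * x) * y)))))"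
    by (intro lborel_integral_real_affine) auto
  also have "\<dots> = (LINT x|lborel. exp (- (\<i> * of_real (2 * pi * (m * y)))) *
      (of_real (exp (- pi * x\<^sup>2)) * exp (\<i> * of_real (2 * pi * (x * (-y))))))"
    by (simp add: algebra_simps exp_diff exp_add exp_minus divide_inverse)
  also have "\<dots> = exp (- (\<i> * of_real (2 * pi * (m * y)))) * of_real (exp (- pi * (-y)\<^sup>2))"
    unfolding integral_mult_right_zero fourier_std_gaussian ..
  finally show ?thesis by (simp add: mult.commute)
qed

lemma norm_exp_phase [simp]: "cmod (exp (\<i> * of_real x)) = 1" "cmod (exp (- (\<i> * of_real x))) = 1"
  by (simp_all add: exp_minus norm_inverse)

text \<open>Expanding the exponential in powers of \<open>\<tau>\<close> and integrating termwise shows that the Fourier integral of a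
function with Gaussian decay is an everywhere convergent power series. Its growth is found by completing the
square: \<open>- (pi * \<alpha> / 2) \<omega>\<^sup>2 + 2 * pi * v * \<omega>\<close> has the maximum \<open>2 * pi * v\<^sup>2 / \<alpha>\<close>.\<close>

lemma entire_fourier_gaussian:
  fixes k :: "real \<Rightarrow> complex" and \<alpha> C :: real
  defines "E \<equiv> (\<lambda>\<tau>::complex. LINT \<omega>|lborel. k \<omega> * exp (\<i> * (of_real (2 * pi * \<omega>) * \<tau>)))"
  assumes k[measurable]: "k \<in> borel_measurable borel" and \<alpha>: "\<alpha> > 0"
    and bound: "AE \<omega> in lborel. cmod (k \<omega>) \<le> C * exp (- (pi * \<alpha> / 2) * \<omega>\<^sup>2)"
  shows "E holomorphic_on UNIV"
    and "cmod (E \<tau>) \<le> C * (LINT \<omega>|lborel. exp (- (pi * \<alpha> / 2) * \<omega>\<^sup>2)) * exp (2 * pi / \<alpha> * (Im \<tau>)\<^sup>2)"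
proof -
  have shift: "exp (- (pi * \<alpha> / 2) * \<omega>\<^sup>2) * exp (2 * pi * v * \<omega>)
      = exp (2 * pi / \<alpha> * v\<^sup>2) * exp (- (pi * \<alpha> / 2) * (\<omega> - 2 * v / \<alpha>)\<^sup>2)" for \<omega> v
    using \<alpha> by (simp add: exp_add[symmetric] power2_eq_square field_simps)
  have gauss: "integrable lborel (\<lambda>\<omega>. exp (- (pi * \<alpha> / 2) * (\<omega> - m)\<^sup>2))" for m
    using \<alpha> by (intro integrable_gaussian) simp
  have dom: "integrable lborel (\<lambda>\<omega>. C * (exp (- (pi * \<alpha> / 2) * \<omega>\<^sup>2) * exp (2 * pi * v * \<omega>)))" for v
    unfolding shift by (intro integrable_mult_right gauss)
  have int_exp: "integrable lborel (\<lambda>\<omega>. cmod (k \<omega>) * exp (2 * pi * v * \<omega>))" for v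
  proof (rule Bochner_Integration.integrable_bound[OF dom[of v]])
    show "AE \<omega> in lborel. norm (cmod (k \<omega>) * exp (2 * pi * v * \<omega>))
        \<le> norm (C * (exp (- (pi * \<alpha> / 2) * \<omega>\<^sup>2) * exp (2 * pi * v * \<omega>)))"
      using bound
    proof eventually_elim
      case (elim \<omega>)
      then have "cmod (k \<omega>) * exp (2 * pi * v * \<omega>) \<le> (C * exp (- (pi * \<alpha> / 2) * \<omega>\<^sup>2)) * exp (2 * pi * v * \<omega>)"
        by (intro mult_right_mono) auto
      then have "cmod (k \<omega>) * exp (2 * pi * v * \<omega>) \<le> C * (exp (- (pi * \<alpha> / 2) * \<omega>\<^sup>2) * exp (2 * pi * v * \<omega>))"
        by (simp only: mult.assoc)
      also have "\<dots> \<le> norm \<dots>" unfolding real_norm_def by (rule abs_ge_self)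
      finally show ?case by (simp only: real_norm_def abs_mult abs_norm_cancel abs_exp_cancel)
    qed
  qed simp
  have int_abs: "integrable lborel (\<lambda>\<omega>. cmod (k \<omega>) * exp (2 * pi * r * \<bar>\<omega>\<bar>))" for r
  proof (rule Bochner_Integration.integrable_bound)
    show "integrable lborel (\<lambda>\<omega>. cmod (k \<omega>) * exp (2 * pi * r * \<omega>) + cmod (k \<omega>) * exp (2 * pi * (-r) * \<omega>))"
      by (intro Bochner_Integration.integrable_add int_exp)
    show "AE \<omega> in lborel. norm (cmod (k \<omega>) * exp (2 * pi * r * \<bar>\<omega>\<bar>))
        \<le> norm (cmod (k \<omega>) * exp (2 * pi * r * \<omega>) + cmod (k \<omega>) * exp (2 * pi * (-r) * \<omega>))"
    proof (intro AE_I2)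
      fix \<omega> :: real
      have "exp (2 * pi * r * \<bar>\<omega>\<bar>) \<le> exp (2 * pi * r * \<omega>) + exp (2 * pi * (-r) * \<omega>)"
        by (cases "\<omega> \<ge> 0") auto
      then have "cmod (k \<omega>) * exp (2 * pi * r * \<bar>\<omega>\<bar>) \<le> cmod (k \<omega>) * (exp (2 * pi * r * \<omega>) + exp (2 * pi * (-r) * \<omega>))"
        by (intro mult_left_mono) auto
      then show "norm (cmod (k \<omega>) * exp (2 * pi * r * \<bar>\<omega>\<bar>))
        \<le> norm (cmod (k \<omega>) * exp (2 * pi * r * \<omega>) + cmod (k \<omega>) * exp (2 * pi * (-r) * \<omega>))"
        unfolding distrib_left real_norm_def by (subst abs_of_nonneg) auto
    qed
  qed simp
  show bd: "cmod (E \<tau>) \<le> C * (LINT \<omega>|lborel. exp (- (pi * \<alpha> / 2) * \<omega>\<^sup>2)) * exp (2 * pi / \<alpha> * (Im \<tau>)\<^sup>2)" for \<tau>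
  proof -
    define v where "v = - Im \<tau>"
    have "cmod (E \<tau>) \<le> (LINT \<omega>|lborel. cmod (k \<omega> * exp (\<i> * (of_real (2 * pi * \<omega>) * \<tau>))))"
      unfolding E_def by (rule integral_norm_bound)
    also have "\<dots> = (LINT \<omega>|lborel. cmod (k \<omega>) * exp (2 * pi * v * \<omega>))"
      by (simp add: norm_mult v_def mult_ac)
    also have "\<dots> \<le> (LINT \<omega>|lborel. C * (exp (- (pi * \<alpha> / 2) * \<omega>\<^sup>2) * exp (2 * pi * v * \<omega>)))"
    proof (intro integral_mono_AE int_exp dom)
      show "AE \<omega> in lborel. cmod (k \<omega>) * exp (2 * pi * v * \<omega>) \<le> C * (exp (- (pi * \<alpha> / 2) * \<omega>\<^sup>2) * exp (2 * pi * v * \<omega>))"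
        using bound
      proof eventually_elim
        case (elim \<omega>)
        then have "cmod (k \<omega>) * exp (2 * pi * v * \<omega>) \<le> (C * exp (- (pi * \<alpha> / 2) * \<omega>\<^sup>2)) * exp (2 * pi * v * \<omega>)"
          by (intro mult_right_mono) auto
        then show ?case by (simp add: mult.assoc)
      qed
    qed
    also have "\<dots> = C * (exp (2 * pi / \<alpha> * v\<^sup>2) * (LINT \<omega>|lborel. exp (- (pi * \<alpha> / 2) * (\<omega> - 2 * v / \<alpha>)\<^sup>2)))"
      unfolding shift by simp
    also have "(LINT \<omega>|lborel. exp (- (pi * \<alpha> / 2) * (\<omega> - 2 * v / \<alpha>)\<^sup>2)) = (LINT \<omega>|lborel. exp (- (pi * \<alpha> / 2) * \<omega>\<^sup>2))"
      by (subst lborel_integral_real_affine[of 1 _ "2 * v / \<alpha>"]) auto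
    finally show ?thesis by (simp add: v_def mult_ac)
  qed
  define c where "c n = (LINT \<omega>|lborel. k \<omega> * (\<i> * of_real (2 * pi * \<omega>)) ^ n / fact n)" for n
  have series: "(\<lambda>n. c n * \<tau> ^ n) sums E \<tau>" for \<tau>
  proof -
    define f where "f n \<omega> = k \<omega> * (\<i> * (of_real (2 * pi * \<omega>) * \<tau>)) ^ n / fact n" for n :: nat and \<omega> :: real
    define W where "W \<omega> = cmod (k \<omega>) * exp (2 * pi * cmod \<tau> * \<bar>\<omega>\<bar>)" for \<omega>
    have W: "integrable lborel W" unfolding W_def by (rule int_abs)
    have f_sums: "(\<lambda>n. f n \<omega>) sums (k \<omega> * exp (\<i> * (of_real (2 * pi * \<omega>) * \<tau>)))" for \<omega>
      using sums_mult[OF exp_converges[of "\<i> * (of_real (2 * pi * \<omega>) * \<tau>)"], of "k \<omega>"]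
      by (simp add: f_def scaleR_conv_of_real divide_inverse mult_ac)
    have nf: "norm (f n \<omega>) = cmod (k \<omega>) * ((2 * pi * cmod \<tau> * \<bar>\<omega>\<bar>) ^ n /\<^sub>R fact n)" for n \<omega>
      by (simp add: f_def norm_mult norm_divide norm_power divide_inverse norm_inverse norm_fact mult_ac)
    have nf_sums: "(\<lambda>n. norm (f n \<omega>)) sums W \<omega>" for \<omega>
      unfolding nf W_def by (intro sums_mult exp_converges)
    have nf_le: "(\<Sum>n<N. norm (f n \<omega>)) \<le> W \<omega>" for N \<omega>
      using nf_sums[of \<omega>] by (metis norm_ge_zero sum_le_suminf sums_unique sums_summable finite_lessThan)
    have f_le: "norm (f n \<omega>) \<le> W \<omega>" for n \<omega>
      using nf_le[of \<omega> "Suc n"] sum_nonneg[of "{..<n}" "\<lambda>n. norm (f n \<omega>)"] by simp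
    have fm[measurable]: "f n \<in> borel_measurable borel" for n unfolding f_def by measurable
    have fi: "integrable lborel (f n)" for n
      by (rule Bochner_Integration.integrable_bound[OF W]) (use f_le in \<open>auto intro!: AE_I2 intro: order_trans[OF _ abs_ge_self]\<close>)
    have "(\<lambda>n. integral\<^sup>L lborel (f n)) sums (LINT \<omega>|lborel. (\<Sum>n. f n \<omega>))"
    proof (rule sums_integral)
      show "AE \<omega> in lborel. summable (\<lambda>n. norm (f n \<omega>))"
        using nf_sums by (auto intro: sums_summable)
      show "summable (\<lambda>n. LINT \<omega>|lborel. norm (f n \<omega>))"
      proof (rule summableI_nonneg_bounded)
        fix N
        have "(\<Sum>n<N. LINT \<omega>|lborel. norm (f n \<omega>)) = (LINT \<omega>|lborel. (\<Sum>n<N. norm (f n \<omega>)))"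
          by (rule Bochner_Integration.integral_sum[symmetric]) (intro integrable_norm fi)
        also have "\<dots> \<le> integral\<^sup>L lborel W"
          by (intro integral_mono W Bochner_Integration.integrable_sum integrable_norm fi nf_le)
        finally show "(\<Sum>n<N. LINT \<omega>|lborel. norm (f n \<omega>)) \<le> integral\<^sup>L lborel W" .
      qed simp
    qed (rule fi)
    moreover have "(LINT \<omega>|lborel. (\<Sum>n. f n \<omega>)) = E \<tau>"
      unfolding E_def using f_sums by (simp add: sums_iff)
    moreover have "integral\<^sup>L lborel (f n) = c n * \<tau> ^ n" for n
    proof -
      have "f n \<omega> = k \<omega> * (\<i> * of_real (2 * pi * \<omega>)) ^ n / fact n * \<tau> ^ n" for \<omega>
        by (simp add: f_def power_mult_distrib mult_ac)
      then have "f n = (\<lambda>\<omega>. k \<omega> * (\<i> * of_real (2 * pi * \<omega>)) ^ n / fact n * \<tau> ^ n)" by (rule ext)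
      then show ?thesis unfolding c_def by (simp only: integral_mult_left_zero)
    qed
    ultimately show ?thesis by simp
  qed
  have "E holomorphic_on ball 0 R" for R
    by (rule power_series_holomorphic[where a = c]) (use series in auto)
  then have "E field_differentiable at z" for z
    using holomorphic_on_imp_differentiable_at[of E "ball 0 (cmod z + 1)" z] by auto
  then show "E holomorphic_on UNIV" by (simp add: holomorphic_on_def field_differentiable_at_within)
qed

lemma continuous_fourier:
  fixes v :: "real \<Rightarrow> complex"
  assumes v: "integrable lborel v"
  shows "continuous_on UNIV (\<lambda>y. LINT t|lborel. v t * exp (- (\<i> * of_real (2 * pi * (t * y)))))"
  unfolding continuous_on_sequentially
proof (safe, unfold o_def)
  fix x :: "nat \<Rightarrow> real" and a assume x: "x \<longlonglongrightarrow> a"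
  have [measurable]: "v \<in> borel_measurable borel" using v by auto
  show "(\<lambda>n. LINT t|lborel. v t * exp (- (\<i> * of_real (2 * pi * (t * x n)))))
      \<longlonglongrightarrow> (LINT t|lborel. v t * exp (- (\<i> * of_real (2 * pi * (t * a)))))"
  proof (rule integral_dominated_convergence[where w = "\<lambda>t. cmod (v t)"])
    show "AE t in lborel. (\<lambda>n. v t * exp (- (\<i> * of_real (2 * pi * (t * x n)))))
        \<longlonglongrightarrow> v t * exp (- (\<i> * of_real (2 * pi * (t * a))))"
      using x by (intro AE_I2 tendsto_intros)
  qed (use v in \<open>auto simp: norm_mult\<close>)
qed

text \<open>If the positive and the negative part of \<open>u\<close> are not both null, they have the same mass (the frequency 0) and,
once normalized, are densities of probability distributions with the same characteristic function.\<close>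

lemma fourier_unique_real:
  fixes u :: "real \<Rightarrow> real"
  assumes u: "integrable lborel u" and zero: "\<And>t. (CLINT x|lborel. u x *\<^sub>R iexp (t * x)) = 0"
  shows "AE x in lborel. u x = 0"
proof -
  have [measurable]: "u \<in> borel_measurable borel" using u by auto
  define p where "p x = max 0 (u x)" for x
  define q where "q x = max 0 (- u x)" for x
  have pq: "u x = p x - q x" for x by (auto simp: p_def q_def)
  have p: "integrable lborel p" and q: "integrable lborel q"
    unfolding p_def q_def
    using u by (auto intro!: Bochner_Integration.integrable_max Bochner_Integration.integrable_minus)
  have [measurable]: "p \<in> borel_measurable borel" "q \<in> borel_measurable borel" using p q by auto
  have nn: "p x \<ge> 0" "q x \<ge> 0" for x by (auto simp: p_def q_def)
  have int: "integrable lborel (\<lambda>x. w x *\<^sub>R iexp (t * x))" if "integrable lborel w" for w :: "real \<Rightarrow> real" and t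
  proof (rule Bochner_Integration.integrable_bound[OF that])
    have [measurable]: "w \<in> borel_measurable borel" using that by auto
    show "(\<lambda>x. w x *\<^sub>R iexp (t * x)) \<in> borel_measurable lborel" by measurable
  qed auto
  have eq: "(CLINT x|lborel. p x *\<^sub>R iexp (t * x)) = (CLINT x|lborel. q x *\<^sub>R iexp (t * x))" for t
    using zero[of t] Bochner_Integration.integral_diff[OF int[OF p] int[OF q], of t t]
    by (simp add: pq scaleR_diff_left)
  define m where "m = integral\<^sup>L lborel p"
  have m: "integral\<^sup>L lborel q = m"
    using eq[of 0] by (simp add: m_def scaleR_conv_of_real)
  show ?thesis
  proof (cases "m = 0")
    case True
    then have "AE x in lborel. p x = 0" "AE x in lborel. q x = 0"
      using integral_nonneg_eq_0_iff_AE[OF p] integral_nonneg_eq_0_iff_AE[OF q] nn m by (auto simp: m_def)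
    then show ?thesis by eventually_elim (simp add: pq)
  next
    case False
    have "m \<ge> 0" unfolding m_def using nn by (intro integral_nonneg_AE) auto
    with False have m0: "m > 0" by simp
    define D where "D w = density lborel (\<lambda>x. ennreal (w x / m))" for w :: "real \<Rightarrow> real"
    have dist: "real_distribution (D w)" if "integrable lborel w" "\<And>x. w x \<ge> 0" "integral\<^sup>L lborel w = m" for w
    proof -
      have [measurable]: "w \<in> borel_measurable borel" using that(1) by auto
      have "emeasure (D w) (space (D w)) = (\<integral>\<^sup>+ x. ennreal (w x / m) \<partial>lborel)"
        unfolding D_def by (subst emeasure_density) (auto intro!: nn_integral_cong)
      also have "\<dots> = ennreal (LINT x|lborel. w x / m)"
        using that m0 by (intro nn_integral_eq_integral) auto
      finally have "emeasure (D w) (space (D w)) = 1" using that m0 by simp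
      then show ?thesis
        by (intro real_distribution.intro prob_spaceI real_distribution_axioms.intro) (auto simp: D_def)
    qed
    have char: "char (D w) t = (CLINT x|lborel. w x *\<^sub>R iexp (t * x)) / m"
      if "integrable lborel w" "\<And>x. w x \<ge> 0" for w t
    proof -
      have [measurable]: "w \<in> borel_measurable borel" using that(1) by auto
      have "char (D w) t = (CLINT x|lborel. (w x / m) *\<^sub>R iexp (t * x))"
        unfolding char_def D_def using that m0 by (subst integral_density) auto
      also have "\<dots> = (CLINT x|lborel. (w x *\<^sub>R iexp (t * x)) / m)"
        by (simp add: scaleR_conv_of_real)
      finally show ?thesis by simp
    qed
    have "char (D p) = char (D q)"
      using char[OF p] char[OF q] nn eq by auto
    then have "D p = D q"
      using dist[OF p] dist[OF q] nn m m_def by (intro Levy_uniqueness) auto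
    then have "AE x in lborel. ennreal (p x / m) = ennreal (q x / m)"
      unfolding D_def by (intro sigma_finite_measure.density_unique[OF sigma_finite_lborel]) auto
    then show ?thesis
      using nn m0 by (auto simp: pq)
  qed
qed

text \<open>The transform is continuous, so its zeros at the rational frequencies determine it. The hypothesis has this form
because a quantifier over a countable set can be moved inside an almost-everywhere statement, as is required when
several variables are treated one after the other.\<close>

lemma fourier_unique_complex:
  fixes v :: "real \<Rightarrow> complex"
  assumes v: "integrable lborel v"
    and zero: "\<And>y. y \<in> \<rat> \<Longrightarrow> (LINT t|lborel. v t * exp (- (\<i> * of_real (2 * pi * (t * y))))) = 0"
  shows "AE t in lborel. v t = 0"
proof -
  have zero': "(LINT t|lborel. v t * exp (- (\<i> * of_real (2 * pi * (t * y))))) = 0" for y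
  proof (rule continuous_constant_on_closure[of \<rat> "\<lambda>y. LINT t|lborel. v t * exp (- (\<i> * of_real (2 * pi * (t * y))))"])
    show "y \<in> closure \<rat>" by (simp add: Rats_closure_real)
  qed (use zero continuous_fourier[OF v] in \<open>auto simp: Rats_closure_real\<close>)
  have int: "integrable lborel (\<lambda>x. v x * iexp (t * x))" for t
    using v by (rule Bochner_Integration.integrable_bound) (use v in \<open>auto simp: norm_mult\<close>)
  have z: "(CLINT x|lborel. v x * iexp (t * x)) = 0" for t
    using zero'[of "- t / (2 * pi)"] by (simp add: mult_ac)
  have zc: "(CLINT x|lborel. cnj (v x) * iexp (t * x)) = 0" for t
  proof -
    have "(CLINT x|lborel. cnj (v x) * iexp (t * x)) = cnj (CLINT x|lborel. v x * iexp ((- t) * x))"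
    proof -
      have "(CLINT x|lborel. cnj (v x) * iexp (t * x)) = (CLINT x|lborel. cnj (v x * iexp ((- t) * x)))"
        by (intro Bochner_Integration.integral_cong refl) (simp add: exp_cnj)
      also have "\<dots> = cnj (CLINT x|lborel. v x * iexp ((- t) * x))"
        by (rule Bochner_Integration.integral_cnj)
      finally show ?thesis .
    qed
    then show ?thesis unfolding z[of "- t"] by simp
  qed
  have intc: "integrable lborel (\<lambda>x. cnj (v x) * iexp (t * x))" for t
    using integrable_cnj[OF int[of "- t"]] by (simp add: exp_cnj)
  have Re_eq: "Re z *\<^sub>R w = (z * w + cnj z * w) * (1 / 2)" and Im_eq: "Im z *\<^sub>R w = (z * w - cnj z * w) * (- \<i> / 2)" for z w
    by (simp_all add: complex_eq_iff field_simps)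
  have "(CLINT x|lborel. Re (v x) *\<^sub>R iexp (t * x)) = 0" for t
    unfolding Re_eq integral_mult_left_zero Bochner_Integration.integral_add[OF int intc] z zc by simp
  then have "AE x in lborel. Re (v x) = 0" using v by (intro fourier_unique_real) auto
  moreover have "(CLINT x|lborel. Im (v x) *\<^sub>R iexp (t * x)) = 0" for t
    unfolding Im_eq integral_mult_left_zero Bochner_Integration.integral_diff[OF int intc] z zc by simp
  then have "AE x in lborel. Im (v x) = 0" using v by (intro fourier_unique_real) auto
  ultimately show ?thesis by eventually_elim (simp add: complex_eq_iff)
qed

section \<open>The Fourier transform on a finite product of real lines\<close>

text \<open>Functions on \<open>\<real>\<^sup>K\<close> are functions on the product measure space over \<open>K\<close>, not on a type: the number of
coordinates in which the partial transform is taken is a value, and induction over the set of coordinates is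
required as well.\<close>

abbreviation lborel_on :: "'i set \<Rightarrow> ('i \<Rightarrow> real) measure" where
  "lborel_on K \<equiv> Pi\<^sub>M K (\<lambda>_. lborel)"

interpretation lborel_on: product_sigma_finite "\<lambda>_. lborel :: real measure"
  by standard

text \<open>Fubini's theorem for splitting off one coordinate; all statements about \<open>insert i I\<close> below are transported
along this measure isomorphism.\<close>

lemma distr_fun_upd:
  assumes "finite I" "i \<notin> I"
  shows "distr (lborel_on I \<Otimes>\<^sub>M lborel) (lborel_on (insert i I)) (\<lambda>(x, y). x(i := y)) = lborel_on (insert i I)"
proof (rule lborel_on.PiM_eqI)
  interpret I: sigma_finite_measure "lborel_on I" using assms by (intro lborel_on.sigma_finite)
  fix A :: "'a \<Rightarrow> real set" assume A: "\<And>j. j \<in> insert i I \<Longrightarrow> A j \<in> sets lborel"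
  have "(\<lambda>(x, y). x(i := y)) -` (Pi\<^sub>E (insert i I) A) \<inter> space (lborel_on I \<Otimes>\<^sub>M lborel) = Pi\<^sub>E I A \<times> A i"
    using assms(2) by (auto simp: space_pair_measure space_PiM PiE_iff extensional_def split: if_splits)
  then have "emeasure (distr (lborel_on I \<Otimes>\<^sub>M lborel) (lborel_on (insert i I)) (\<lambda>(x, y). x(i := y))) (Pi\<^sub>E (insert i I) A)
      = emeasure (lborel_on I \<Otimes>\<^sub>M lborel) (Pi\<^sub>E I A \<times> A i)"
    using A assms by (subst emeasure_distr) (auto intro!: sets_PiM_I_finite)
  also have "\<dots> = emeasure (lborel_on I) (Pi\<^sub>E I A) * emeasure lborel (A i)"
    using A assms by (intro lborel.emeasure_pair_measure_Times sets_PiM_I_finite) auto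
  also have "\<dots> = (\<Prod>j\<in>insert i I. emeasure lborel (A j))"
    using A assms by (subst lborel_on.emeasure_PiM) (auto simp: mult.commute)
  finally show "emeasure (distr (lborel_on I \<Otimes>\<^sub>M lborel) (lborel_on (insert i I)) (\<lambda>(x, y). x(i := y))) (Pi\<^sub>E (insert i I) A)
      = (\<Prod>j\<in>insert i I. emeasure lborel (A j))" .
qed (use assms in auto)

lemma pair_sigma_finite_lborel_on:
  assumes "finite I"
  shows "pair_sigma_finite (lborel_on I) (lborel :: real measure)"
  using assms by (intro pair_sigma_finite.intro lborel_on.sigma_finite sigma_finite_lborel)

lemma AE_lborel_on_insertD:
  assumes "finite I" "i \<notin> I" and "AE x in lborel_on (insert i I). P x"
  shows "AE x in lborel_on I. AE y in lborel. P (x(i := y))"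
proof -
  interpret pair_sigma_finite "lborel_on I" "lborel :: real measure"
    using assms(1) by (rule pair_sigma_finite_lborel_on)
  have "AE z in lborel_on I \<Otimes>\<^sub>M lborel. P ((\<lambda>(x, y). x(i := y)) z)"
    by (rule AE_distrD[OF measurable_add_dim]) (use assms distr_fun_upd in metis)
  from AE_pair[OF this] show ?thesis by simp
qed

lemma AE_lborel_on_insertI:
  assumes "finite I" "i \<notin> I" and P: "{x \<in> space (lborel_on (insert i I)). P x} \<in> sets (lborel_on (insert i I))"
    and AE: "AE x in lborel_on I. AE y in lborel. P (x(i := y))"
  shows "AE x in lborel_on (insert i I). P x"
proof -
  interpret pair_sigma_finite "lborel_on I" "lborel :: real measure"
    using assms(1) by (rule pair_sigma_finite_lborel_on)
  have "{z \<in> space (lborel_on I \<Otimes>\<^sub>M lborel). P ((\<lambda>(x, y). x(i := y)) z)} \<in> sets (lborel_on I \<Otimes>\<^sub>M lborel)"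
    by (rule measurable_sets_Collect[OF measurable_add_dim P])
  then have "AE z in lborel_on I \<Otimes>\<^sub>M lborel. P ((\<lambda>(x, y). x(i := y)) z)"
    using AE by (intro AE_pair_measure) auto
  then have "AE x in distr (lborel_on I \<Otimes>\<^sub>M lborel) (lborel_on (insert i I)) (\<lambda>(x, y). x(i := y)). P x"
    by (subst AE_distr_iff[OF measurable_add_dim P])
  then show ?thesis unfolding distr_fun_upd[OF assms(1,2)] .
qed

lemma integrable_lborel_on_insert:
  fixes v :: "('i \<Rightarrow> real) \<Rightarrow> 'b::{banach, second_countable_topology}"
  assumes "finite I" "i \<notin> I" and "integrable (lborel_on (insert i I)) v"
  shows "integrable (lborel_on I \<Otimes>\<^sub>M lborel) (\<lambda>(x, y). v (x(i := y)))"
proof -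
  have "integrable (lborel_on I \<Otimes>\<^sub>M lborel) (\<lambda>z. v ((\<lambda>(x, y). x(i := y)) z))"
    by (rule integrable_distr[OF measurable_add_dim]) (use assms in \<open>simp add: distr_fun_upd\<close>)
  then show ?thesis by (simp add: case_prod_beta')
qed

definition fourier_on :: "'i set \<Rightarrow> (('i \<Rightarrow> real) \<Rightarrow> complex) \<Rightarrow> ('i \<Rightarrow> real) \<Rightarrow> complex" where
  "fourier_on K h \<omega> = (LINT t|lborel_on K. h t * exp (- (\<i> * of_real (2 * pi * (\<Sum>i\<in>K. t i * \<omega> i)))))"

lemma integrable_mult_unimodular:
  fixes h :: "'a \<Rightarrow> complex"
  assumes "integrable M h" "u \<in> borel_measurable M" "\<And>x. cmod (u x) = 1"
  shows "integrable M (\<lambda>x. h x * u x)"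
  using assms by (intro Bochner_Integration.integrable_bound[OF assms(1)]) (auto simp: norm_mult)

lemma borel_measurable_phase:
  "(\<lambda>t. exp (- (\<i> * of_real (2 * pi * (\<Sum>i\<in>K. t i * z i))))) \<in> borel_measurable (lborel_on K)"
  by measurable

lemma fourier_on_insert:
  assumes "finite K" "i \<notin> K" and v: "integrable (lborel_on (insert i K)) v"
  shows "fourier_on (insert i K) v (\<xi>(i := y))
      = fourier_on K (\<lambda>x. LINT s|lborel. v (x(i := s)) * exp (- (\<i> * of_real (2 * pi * (s * y))))) \<xi>"
proof -
  have eq: "v (x(i := s)) * exp (- (\<i> * of_real (2 * pi * (\<Sum>j\<in>insert i K. (x(i := s)) j * (\<xi>(i := y)) j))))
      = (v (x(i := s)) * exp (- (\<i> * of_real (2 * pi * (s * y))))) * exp (- (\<i> * of_real (2 * pi * (\<Sum>j\<in>K. x j * \<xi> j))))" for x s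
  proof -
    have "(\<Sum>j\<in>K. (x(i := s)) j * (\<xi>(i := y)) j) = (\<Sum>j\<in>K. x j * \<xi> j)"
      using assms(2) by (intro sum.cong) auto
    then have sum: "(\<Sum>j\<in>insert i K. (x(i := s)) j * (\<xi>(i := y)) j) = s * y + (\<Sum>j\<in>K. x j * \<xi> j)"
      using assms(1,2) by simp
    have "exp (- (\<i> * complex_of_real (2 * pi * (a + b)))) = exp (- (\<i> * of_real (2 * pi * a))) * exp (- (\<i> * of_real (2 * pi * b)))" for a b
      by (simp add: algebra_simps flip: exp_add)
    then show ?thesis unfolding sum by (simp only: mult.assoc)
  qed
  have "integrable (lborel_on (insert i K)) (\<lambda>t. v t * exp (- (\<i> * of_real (2 * pi * (\<Sum>j\<in>insert i K. t j * (\<xi>(i := y)) j)))))"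
    by (intro integrable_mult_unimodular v borel_measurable_phase norm_exp_phase)
  then have "fourier_on (insert i K) v (\<xi>(i := y)) = (LINT x|lborel_on K. LINT s|lborel.
      v (x(i := s)) * exp (- (\<i> * of_real (2 * pi * (\<Sum>j\<in>insert i K. (x(i := s)) j * (\<xi>(i := y)) j)))))"
    unfolding fourier_on_def by (rule lborel_on.product_integral_insert[OF assms(1,2)])
  also have "\<dots> = fourier_on K (\<lambda>x. LINT s|lborel. v (x(i := s)) * exp (- (\<i> * of_real (2 * pi * (s * y))))) \<xi>"
    unfolding eq fourier_on_def integral_mult_left_zero ..
  finally show ?thesis .
qed

text \<open>Induction on the number of coordinates. Transforming in the coordinate \<open>i\<close> alone at a fixed frequency \<open>y\<close>
gives a function of the other coordinates whose transform vanishes, so it is null for each of the countably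
many rational \<open>y\<close>; hence almost every slice in direction \<open>i\<close> has a transform vanishing at all rational
frequencies, and the one-dimensional case applies to it.\<close>

theorem fourier_on_unique:
  assumes "finite K" "integrable (lborel_on K) v" "\<And>\<omega>. fourier_on K v \<omega> = 0"
  shows "AE t in lborel_on K. v t = 0"
  using assms
proof (induction K arbitrary: v rule: finite_induct)
  case empty
  have "fourier_on {} v undefined = v (\<lambda>_. undefined)"
    unfolding fourier_on_def by (simp add: PiM_empty lebesgue_integral_count_space_finite)
  then have "v (\<lambda>_. undefined) = 0" using empty by simp
  then show ?case unfolding PiM_empty AE_count_space by simp
next
  case (insert i K)
  interpret pair_sigma_finite "lborel_on K" "lborel :: real measure"
    using insert(1) by (rule pair_sigma_finite_lborel_on)
  have [measurable]: "v \<in> borel_measurable (lborel_on (insert i K))" using insert by auto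
  have int: "integrable (lborel_on K \<Otimes>\<^sub>M lborel) (\<lambda>(x, s). v (x(i := s)))"
    using insert by (intro integrable_lborel_on_insert)
  define w where "w y x = (LINT s|lborel. v (x(i := s)) * exp (- (\<i> * of_real (2 * pi * (s * y)))))" for y x
  have "AE x in lborel_on K. w y x = 0" for y
  proof (rule insert.IH)
    have "integrable (lborel_on K \<Otimes>\<^sub>M lborel) (\<lambda>z. (case z of (x, s) \<Rightarrow> v (x(i := s))) * exp (- (\<i> * of_real (2 * pi * (snd z * y)))))"
      by (intro integrable_mult_unimodular int) auto
    from integrable_fst'[OF this] show "integrable (lborel_on K) (w y)"
      unfolding w_def by simp
    show "fourier_on K (w y) \<omega> = 0" for \<omega>
      unfolding w_def by (simp only: fourier_on_insert[OF insert(1,2,4), of \<omega> y, symmetric] insert.prems(2))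
  qed
  then have "AE x in lborel_on K. \<forall>y\<in>\<rat>. w y x = 0"
    using countable_rat by (subst AE_ball_countable) auto
  moreover have "AE x in lborel_on K. integrable lborel (\<lambda>s. v (x(i := s)))"
    using AE_integrable_fst'[OF int] by simp
  ultimately have ae: "AE x in lborel_on K. AE s in lborel. v (x(i := s)) = 0"
    by eventually_elim (intro fourier_unique_complex, auto simp: w_def)
  show ?case by (rule AE_lborel_on_insertI[OF insert(1,2) _ ae]) measurable
qed

definition gauss_on :: "'i set \<Rightarrow> ('i \<Rightarrow> real) \<Rightarrow> complex" where
  "gauss_on K t = (\<Prod>i\<in>K. of_real (exp (- pi * (t i)\<^sup>2)))"

lemma gauss_on_nonzero [simp]: "gauss_on K t \<noteq> 0"
  by (cases "finite K") (auto simp: gauss_on_def)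

lemma exp_phase_eq_prod:
  "exp (- (\<i> * of_real (2 * pi * (\<Sum>i\<in>K. t i * \<omega> i)))) = (\<Prod>i\<in>K. exp (- (\<i> * of_real (2 * pi * (t i * \<omega> i)))))"
  by (cases "finite K") (simp_all add: exp_sum[symmetric] sum_distrib_left sum_negf)

lemma fourier_on_gauss:
  assumes "finite K"
  shows "integrable (lborel_on K) (\<lambda>t. gauss_on K (\<lambda>i. t i - m i))"
    and "fourier_on K (\<lambda>t. gauss_on K (\<lambda>i. t i - m i)) \<omega>
      = gauss_on K \<omega> * exp (- (\<i> * of_real (2 * pi * (\<Sum>i\<in>K. m i * \<omega> i))))"
proof -
  have g: "integrable lborel (\<lambda>s. complex_of_real (exp (- pi * (s - a)\<^sup>2)))" for a
    using integrable_gaussian[of pi a] by simp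
  show "integrable (lborel_on K) (\<lambda>t. gauss_on K (\<lambda>i. t i - m i))"
    unfolding gauss_on_def using assms g by (rule lborel_on.product_integrable_prod)
  have "fourier_on K (\<lambda>t. gauss_on K (\<lambda>i. t i - m i)) \<omega>
    = (LINT t|lborel_on K. (\<Prod>i\<in>K. of_real (exp (- pi * (t i - m i)\<^sup>2)) * exp (- (\<i> * of_real (2 * pi * (t i * \<omega> i))))))"
    unfolding fourier_on_def gauss_on_def exp_phase_eq_prod prod.distrib ..
  also have "\<dots> = (\<Prod>i\<in>K. LINT s|lborel. of_real (exp (- pi * (s - m i)\<^sup>2)) * exp (- (\<i> * of_real (2 * pi * (s * \<omega> i)))))"
    by (intro lborel_on.product_integral_prod assms integrable_mult_unimodular g) auto
  also have "\<dots> = gauss_on K \<omega> * exp (- (\<i> * of_real (2 * pi * (\<Sum>i\<in>K. m i * \<omega> i))))"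
    unfolding fourier_shifted_gaussian gauss_on_def exp_phase_eq_prod prod.distrib ..
  finally show "fourier_on K (\<lambda>t. gauss_on K (\<lambda>i. t i - m i)) \<omega>
      = gauss_on K \<omega> * exp (- (\<i> * of_real (2 * pi * (\<Sum>i\<in>K. m i * \<omega> i))))" .
qed

lemma (in pair_sigma_finite) integrable_tensor:
  fixes f :: "'a \<Rightarrow> 'c::{real_normed_field, banach, second_countable_topology}"
  assumes f: "integrable M1 f" and g: "integrable M2 g"
  shows "integrable (M1 \<Otimes>\<^sub>M M2) (\<lambda>z. f (fst z) * g (snd z))"
proof (rule Fubini_integrable)
  have [measurable]: "f \<in> borel_measurable M1" "g \<in> borel_measurable M2" using f g by auto
  show "(\<lambda>z. f (fst z) * g (snd z)) \<in> borel_measurable (M1 \<Otimes>\<^sub>M M2)" by measurable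
qed (use f g in \<open>auto simp: norm_mult\<close>)

lemma borel_measurable_fourier_on:
  assumes "finite K" and [measurable]: "h \<in> borel_measurable (lborel_on K)"
    and "\<And>i. i \<in> K \<Longrightarrow> (\<lambda>x. \<phi> x i) \<in> borel_measurable N"
  shows "(\<lambda>x. fourier_on K h (\<phi> x)) \<in> borel_measurable N"
proof -
  interpret sigma_finite_measure "lborel_on K" using assms by (intro lborel_on.sigma_finite)
  note assms(3)[measurable]
  show ?thesis unfolding fourier_on_def by measurable
qed

text \<open>Let \<open>H\<close> be the inverse transform of the transform of \<open>h\<close>. As \<open>H\<close> is only known to be bounded, both
\<open>h\<close> and \<open>H\<close> are multiplied by a Gaussian. By Fubini and the self-duality of the Gaussian, the two products
have the same transform (the convolution of the transform of \<open>h\<close> with a Gaussian), so they agree by uniqueness,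
and the Gaussian has no zeros.\<close>

theorem fourier_on_inversion:
  assumes K: "finite K" and h: "integrable (lborel_on K) h" and h': "integrable (lborel_on K) (fourier_on K h)"
  shows "AE t in lborel_on K. h t = fourier_on K (fourier_on K h) (\<lambda>i. - t i)"
proof -
  interpret sigma_finite_measure "lborel_on K" using K by (intro lborel_on.sigma_finite)
  interpret pair_sigma_finite "lborel_on K" "lborel_on K" by standard
  define H where "H t = fourier_on K (fourier_on K h) (\<lambda>i. - t i)" for t
  have [measurable]: "h \<in> borel_measurable (lborel_on K)" "fourier_on K h \<in> borel_measurable (lborel_on K)"
    using h h' by auto
  have [measurable]: "H \<in> borel_measurable (lborel_on K)"
    unfolding H_def by (intro borel_measurable_fourier_on K) auto
  define e :: "('a \<Rightarrow> real) \<Rightarrow> ('a \<Rightarrow> real) \<Rightarrow> complex"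
    where "e t \<omega> = exp (- (\<i> * of_real (2 * pi * (\<Sum>i\<in>K. t i * \<omega> i))))" for t \<omega>
  have e_norm: "cmod (e t \<omega>) = 1" for t \<omega> by (simp add: e_def)
  have e_comm: "e t \<omega> = e \<omega> t" for t \<omega> by (simp add: e_def mult.commute)
  have [measurable]: "(\<lambda>z. e (fst z) (snd z)) \<in> borel_measurable (lborel_on K \<Otimes>\<^sub>M lborel_on K)"
    unfolding e_def by measurable
  have g: "integrable (lborel_on K) (gauss_on K)"
    using fourier_on_gauss(1)[OF K, of "\<lambda>_. 0"] by simp
  then have [measurable]: "gauss_on K \<in> borel_measurable (lborel_on K)" by auto
  have H_le: "cmod (H t) \<le> (LINT \<omega>|lborel_on K. cmod (fourier_on K h \<omega>))" for t
  proof -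
    have "cmod (H t) \<le> (LINT \<omega>|lborel_on K. cmod (fourier_on K h \<omega> * exp (- (\<i> * of_real (2 * pi * (\<Sum>i\<in>K. \<omega> i * - t i))))))"
      unfolding H_def by (subst (1) fourier_on_def) (rule integral_norm_bound)
    then show ?thesis by (simp only: norm_mult norm_exp_phase mult_1_right)
  qed
  have g_norm: "cmod (gauss_on K t) \<le> 1" for t
    unfolding gauss_on_def prod_norm[symmetric] by (intro prod_le_1) auto
  have int1: "integrable (lborel_on K) (\<lambda>t. h t * gauss_on K t)"
    by (rule Bochner_Integration.integrable_bound[OF h])
      (auto simp: norm_mult intro!: mult_left_le g_norm)
  have int2: "integrable (lborel_on K) (\<lambda>t. H t * gauss_on K t)"
  proof (rule Bochner_Integration.integrable_bound)
    show "integrable (lborel_on K) (\<lambda>t. complex_of_real (LINT \<omega>|lborel_on K. cmod (fourier_on K h \<omega>)) * gauss_on K t)"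
      using g by simp
    show "AE t in lborel_on K. cmod (H t * gauss_on K t)
        \<le> cmod (complex_of_real (LINT \<omega>|lborel_on K. cmod (fourier_on K h \<omega>)) * gauss_on K t)"
      using H_le by (auto simp: norm_mult intro!: mult_right_mono order_trans[OF _ abs_ge_self])
  qed simp
  have "fourier_on K (\<lambda>t. h t * gauss_on K t) \<xi> = fourier_on K (\<lambda>t. H t * gauss_on K t) \<xi>" for \<xi>
  proof -
    let ?G = "\<lambda>\<omega>. gauss_on K (\<lambda>i. \<omega> i - \<xi> i)"
    have G: "integrable (lborel_on K) ?G" by (rule fourier_on_gauss(1)[OF K])
    have "fourier_on K (\<lambda>t. h t * gauss_on K t) \<xi> = (LINT t|lborel_on K. h t * (gauss_on K t * e t \<xi>))"
      by (simp add: fourier_on_def e_def mult.assoc)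
    also have "\<dots> = (LINT t|lborel_on K. LINT \<omega>|lborel_on K. h t * (?G \<omega> * e \<omega> t))"
    proof (intro Bochner_Integration.integral_cong refl)
      fix t
      \<comment> \<open>a modulated Gaussian is the transform of a translated one\<close>
      have "gauss_on K t * e t \<xi> = fourier_on K ?G t"
        unfolding fourier_on_gauss(2)[OF K] e_comm[of t] by (simp add: e_def)
      then show "h t * (gauss_on K t * e t \<xi>) = (LINT \<omega>|lborel_on K. h t * (?G \<omega> * e \<omega> t))"
        by (simp add: fourier_on_def e_def)
    qed
    also have "\<dots> = (LINT \<omega>|lborel_on K. LINT t|lborel_on K. h t * (?G \<omega> * e \<omega> t))"
    proof (rule Fubini_integral[symmetric])
      have "integrable (lborel_on K \<Otimes>\<^sub>M lborel_on K) (\<lambda>z. (h (fst z) * ?G (snd z)) * e (fst z) (snd z))"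
        by (intro integrable_mult_unimodular integrable_tensor h G e_norm) measurable
      then show "integrable (lborel_on K \<Otimes>\<^sub>M lborel_on K) (\<lambda>(t, \<omega>). h t * (?G \<omega> * e \<omega> t))"
        by (simp add: case_prod_beta' mult.assoc e_comm)
    qed
    also have "\<dots> = (LINT \<omega>|lborel_on K. ?G \<omega> * fourier_on K h \<omega>)"
    proof (intro Bochner_Integration.integral_cong refl)
      fix \<omega>
      have "(LINT t|lborel_on K. h t * (?G \<omega> * e \<omega> t)) = (LINT t|lborel_on K. ?G \<omega> * (h t * e t \<omega>))"
        by (intro Bochner_Integration.integral_cong refl) (simp add: e_comm[of \<omega>])
      then show "(LINT t|lborel_on K. h t * (?G \<omega> * e \<omega> t)) = ?G \<omega> * fourier_on K h \<omega>"
        by (simp add: fourier_on_def e_def)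
    qed
    also have "\<dots> = (LINT \<omega>|lborel_on K. LINT t|lborel_on K. fourier_on K h \<omega> * e \<omega> (\<lambda>i. - t i) * (gauss_on K t * e t \<xi>))"
    proof (intro Bochner_Integration.integral_cong refl)
      fix \<omega>
      have "(LINT t|lborel_on K. fourier_on K h \<omega> * e \<omega> (\<lambda>i. - t i) * (gauss_on K t * e t \<xi>))
          = (LINT t|lborel_on K. fourier_on K h \<omega> * (gauss_on K t * e t (\<lambda>i. \<xi> i - \<omega> i)))"
      proof (intro Bochner_Integration.integral_cong refl)
        fix t
        have "e \<omega> (\<lambda>i. - t i) * e t \<xi> = e t (\<lambda>i. \<xi> i - \<omega> i)"
          unfolding e_def exp_add[symmetric]
          by (intro arg_cong[where f = exp]) (simp add: sum_subtractf sum_negf algebra_simps)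
        then show "fourier_on K h \<omega> * e \<omega> (\<lambda>i. - t i) * (gauss_on K t * e t \<xi>)
          = fourier_on K h \<omega> * (gauss_on K t * e t (\<lambda>i. \<xi> i - \<omega> i))"
          by (metis mult.assoc mult.left_commute)
      qed
      also have "\<dots> = fourier_on K h \<omega> * fourier_on K (gauss_on K) (\<lambda>i. \<xi> i - \<omega> i)"
        by (simp add: fourier_on_def e_def)
      also have "fourier_on K (gauss_on K) (\<lambda>i. \<xi> i - \<omega> i) = gauss_on K (\<lambda>i. \<xi> i - \<omega> i)"
        using fourier_on_gauss(2)[OF K, of "\<lambda>_. 0"] by simp
      also have "\<dots> = ?G \<omega>" unfolding gauss_on_def by (simp add: power2_commute)
      finally show "?G \<omega> * fourier_on K h \<omega>
        = (LINT t|lborel_on K. fourier_on K h \<omega> * e \<omega> (\<lambda>i. - t i) * (gauss_on K t * e t \<xi>))" by simp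
    qed
    also have "\<dots> = (LINT t|lborel_on K. LINT \<omega>|lborel_on K. fourier_on K h \<omega> * e \<omega> (\<lambda>i. - t i) * (gauss_on K t * e t \<xi>))"
    proof (rule Fubini_integral)
      have "integrable (lborel_on K \<Otimes>\<^sub>M lborel_on K) (\<lambda>z. (gauss_on K (fst z) * fourier_on K h (snd z))
          * (e (snd z) (\<lambda>i. - fst z i) * e (fst z) \<xi>))"
        by (intro integrable_mult_unimodular integrable_tensor g h')
          (unfold e_def, measurable, simp add: norm_mult)
      then show "integrable (lborel_on K \<Otimes>\<^sub>M lborel_on K) (\<lambda>(t, \<omega>). fourier_on K h \<omega> * e \<omega> (\<lambda>i. - t i) * (gauss_on K t * e t \<xi>))"
        by (simp add: case_prod_beta' mult_ac)
    qed
    also have "\<dots> = fourier_on K (\<lambda>t. H t * gauss_on K t) \<xi>"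
    proof -
      have "H t = (LINT \<omega>|lborel_on K. fourier_on K h \<omega> * e \<omega> (\<lambda>i. - t i))" for t
        unfolding H_def e_def by (subst fourier_on_def) (rule refl)
      then show ?thesis
        unfolding fourier_on_def[of K "\<lambda>t. H t * gauss_on K t"] e_def[symmetric]
        by (simp only: integral_mult_left_zero) (simp only: mult.assoc)
    qed
    finally show ?thesis .
  qed
  moreover have "fourier_on K (\<lambda>t. h t * gauss_on K t - H t * gauss_on K t) \<xi>
      = fourier_on K (\<lambda>t. h t * gauss_on K t) \<xi> - fourier_on K (\<lambda>t. H t * gauss_on K t) \<xi>" for \<xi>
    unfolding fourier_on_def left_diff_distrib
    by (intro Bochner_Integration.integral_diff integrable_mult_unimodular int1 int2) auto
  ultimately have "AE t in lborel_on K. h t * gauss_on K t - H t * gauss_on K t = 0"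
    using int1 int2 by (intro fourier_on_unique K) auto
  then show ?thesis
    by eventually_elim (simp add: H_def flip: left_diff_distrib)
qed

text \<open>The quantifiers of the iterated statement cannot be exchanged for an arbitrary \<open>P\<close>; the coordinates are therefore
swapped earlier, in the product measure.\<close>

lemma AE_lborel_on_insertD':
  assumes "finite I" "i \<notin> I" and "AE x in lborel_on (insert i I). P x"
  shows "AE y in lborel. AE x in lborel_on I. P (x(i := y))"
proof -
  interpret pair_sigma_finite "lborel_on I" "lborel :: real measure"
    using assms(1) by (rule pair_sigma_finite_lborel_on)
  interpret Q: pair_sigma_finite "lborel :: real measure" "lborel_on I" by standard
  have "AE z in lborel_on I \<Otimes>\<^sub>M lborel. P ((\<lambda>(x, y). x(i := y)) z)"
    by (rule AE_distrD[OF measurable_add_dim]) (use assms distr_fun_upd in metis)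
  then have "AE z in lborel \<Otimes>\<^sub>M lborel_on I. P ((\<lambda>(x, y). x(i := y)) ((\<lambda>(y, x). (x, y)) z))"
    by (subst (asm) distr_pair_swap) (rule AE_distrD[OF measurable_pair_swap'])
  from Q.AE_pair[OF this] show ?thesis by simp
qed

text \<open>With the coordinate \<open>i\<close> integrated last, the transform is a one-dimensional Fourier integral in that coordinate.\<close>

lemma fourier_on_insert_rev:
  assumes K: "finite K" "i \<notin> K" and v: "integrable (lborel_on (insert i K)) v"
  shows "fourier_on (insert i K) v (\<xi>(i := y))
      = (LINT s|lborel. fourier_on K (\<lambda>x. v (x(i := s))) \<xi> * exp (- (\<i> * of_real (2 * pi * (s * y)))))"
proof -
  interpret pair_sigma_finite "lborel_on K" "lborel :: real measure"
    using K(1) by (rule pair_sigma_finite_lborel_on)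
  define e where "e x = exp (- (\<i> * of_real (2 * pi * (\<Sum>i\<in>K. x i * \<xi> i))))" for x
  define c where "c s = exp (- (\<i> * complex_of_real (2 * pi * (s * y))))" for s
  have [measurable]: "e \<in> borel_measurable (lborel_on K)" "c \<in> borel_measurable borel"
    unfolding e_def c_def by (rule borel_measurable_phase, measurable)
  have "fourier_on (insert i K) v (\<xi>(i := y)) = (LINT x|lborel_on K. LINT s|lborel. v (x(i := s)) * c s * e x)"
    unfolding fourier_on_insert[OF K v] unfolding fourier_on_def e_def[symmetric] c_def[symmetric] integral_mult_left_zero ..
  also have "\<dots> = (LINT s|lborel. LINT x|lborel_on K. v (x(i := s)) * c s * e x)"
  proof (rule Fubini_integral[symmetric])
    have "integrable (lborel_on K \<Otimes>\<^sub>M lborel) (\<lambda>z. (case z of (x, s) \<Rightarrow> v (x(i := s))) * (c (snd z) * e (fst z)))"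
      by (intro integrable_mult_unimodular integrable_lborel_on_insert K v) (measurable, simp add: norm_mult c_def e_def)
    then show "integrable (lborel_on K \<Otimes>\<^sub>M lborel) (\<lambda>(x, s). v (x(i := s)) * c s * e x)"
      by (simp only: case_prod_beta' mult.assoc)
  qed
  also have "\<dots> = (LINT s|lborel. (LINT x|lborel_on K. v (x(i := s)) * e x) * c s)"
  proof (intro Bochner_Integration.integral_cong refl)
    fix s
    have "(LINT x|lborel_on K. v (x(i := s)) * c s * e x) = (LINT x|lborel_on K. v (x(i := s)) * e x * c s)"
      by (intro Bochner_Integration.integral_cong refl) (simp only: mult_ac)
    then show "(LINT x|lborel_on K. v (x(i := s)) * c s * e x) = (LINT x|lborel_on K. v (x(i := s)) * e x) * c s"
      by (simp only: integral_mult_left_zero)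
  qed
  finally show ?thesis unfolding fourier_on_def e_def c_def .
qed

section \<open>An uncertainty principle of Hardy type\<close>

lemma AE_lborel_continuous_le:
  fixes f g :: "real \<Rightarrow> real"
  assumes "continuous_on UNIV f" "continuous_on UNIV g" and AE: "AE x in lborel. f x \<le> g x"
  shows "f x \<le> g x"
proof (rule ccontr)
  assume "\<not> f x \<le> g x"
  then have "x \<in> {x. g x < f x}" by simp
  moreover have "open {x. g x < f x}" using assms by (intro open_Collect_less)
  ultimately have "\<not> negligible {x. g x < f x}" using open_not_negligible by blast
  moreover have "{x. g x < f x} \<in> null_sets lebesgue"
    using AE_completion[OF AE] AE_iff_null_sets[of "{x. g x < f x}" lebesgue] \<open>open {x. g x < f x}\<close>
    by (simp add: not_less)
  ultimately show False by (simp add: negligible_iff_null_sets)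
qed

text \<open>If \<open>u\<close> is not null, then some \<open>x\<close> with \<open>u x \<noteq> 0\<close> is among the good points of the hypothesis, and this single
\<open>x\<close> already shows that \<open>u\<close> is null.\<close>

lemma AE_mult_self_eq_zero:
  fixes u :: "'a \<Rightarrow> 'b::semiring_no_zero_divisors"
  assumes "AE x in M. AE y in M. u x * u y = 0"
  shows "AE x in M. u x = 0"
proof (rule ccontr)
  assume *: "\<not> (AE x in M. u x = 0)"
  have "\<exists>x. u x \<noteq> 0 \<and> (AE y in M. u x * u y = 0)"
  proof (rule ccontr)
    assume "\<not> ?thesis"
    with assms have "AE x in M. u x = 0" by (auto elim: eventually_mono)
    with * show False ..
  qed
  then show False using * by auto
qed

lemma AE_disj_separate:
  assumes "AE x in M. AE y in N. P x \<or> Q y"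
  shows "(AE x in M. P x) \<or> (AE y in N. Q y)"
proof (cases "AE y in N. Q y")
  case False
  have "P x" if "AE y in N. P x \<or> Q y" for x
    using that False by (cases "P x") auto
  then have "AE x in M. P x" by (intro eventually_mono[OF assms])
  then show ?thesis ..
qed simp

lemma gaussian_lborel_on:
  fixes a :: real
  assumes "finite K" "a > 0"
  shows "integrable (lborel_on K) (\<lambda>\<omega>. exp (- a * (\<Sum>j\<in>K. (\<omega> j)\<^sup>2)))"
proof -
  have "integrable (lborel_on K) (\<lambda>\<omega>. \<Prod>j\<in>K. exp (- a * (\<omega> j)\<^sup>2))"
    using integrable_gaussian[OF assms(2), of 0] by (intro lborel_on.product_integrable_prod assms) simp
  then show ?thesis using assms(1) by (simp add: exp_sum sum_distrib_left sum_negf[symmetric])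
qed

lemma fourier_on_gaussian_bound:
  fixes u :: "('i \<Rightarrow> real) \<Rightarrow> complex"
  assumes K: "finite K" and a: "a > 0" and [measurable]: "u \<in> borel_measurable (lborel_on K)"
    and bound: "AE \<omega> in lborel_on K. cmod (u \<omega>) \<le> B * exp (- a * (\<Sum>j\<in>K. (\<omega> j)\<^sup>2))"
  shows "integrable (lborel_on K) u"
    and "cmod (fourier_on K u t) \<le> B * (LINT \<omega>|lborel_on K. exp (- a * (\<Sum>j\<in>K. (\<omega> j)\<^sup>2)))"
proof -
  have dom: "integrable (lborel_on K) (\<lambda>\<omega>. B * exp (- a * (\<Sum>j\<in>K. (\<omega> j)\<^sup>2)))"
    by (intro integrable_mult_right gaussian_lborel_on K a)
  show int: "integrable (lborel_on K) u"
  proof (rule Bochner_Integration.integrable_bound[OF dom])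
    show "AE \<omega> in lborel_on K. cmod (u \<omega>) \<le> norm (B * exp (- a * (\<Sum>j\<in>K. (\<omega> j)\<^sup>2)))"
      using bound unfolding real_norm_def by eventually_elim (rule order_trans[OF _ abs_ge_self])
  qed simp
  have "cmod (fourier_on K u t) \<le> (LINT \<omega>|lborel_on K. cmod (u \<omega> * exp (- (\<i> * of_real (2 * pi * (\<Sum>j\<in>K. \<omega> j * t j))))))"
    unfolding fourier_on_def by (rule integral_norm_bound)
  also have "\<dots> = (LINT \<omega>|lborel_on K. cmod (u \<omega>))"
    by (simp only: norm_mult norm_exp_phase mult_1_right)
  also have "\<dots> \<le> (LINT \<omega>|lborel_on K. B * exp (- a * (\<Sum>j\<in>K. (\<omega> j)\<^sup>2)))"
    by (intro integral_mono_AE bound dom integrable_norm int)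
  finally show "cmod (fourier_on K u t) \<le> B * (LINT \<omega>|lborel_on K. exp (- a * (\<Sum>j\<in>K. (\<omega> j)\<^sup>2)))"
    by simp
qed

text \<open>This is the form in which Hardy's uncertainty principle enters. The decay of the transform makes \<open>h\<close>, corrected
on a null set, an entire function \<open>E\<close> of the single coordinate \<open>i\<close> with growth \<open>exp (2 * pi / \<alpha> * v\<^sup>2)\<close> in the
imaginary direction. For two lines in direction \<open>i\<close>, with the other coordinates \<open>t\<close> and \<open>s\<close>, the entire function
\<open>w \<mapsto> E t (\<sigma> + w) * E s (\<sigma> - w)\<close> has growth \<open>exp (4 * pi / \<alpha> * v\<^sup>2)\<close> and, by the second
hypothesis, decay \<open>exp (- 4 * pi * \<alpha> * w\<^sup>2)\<close> for real \<open>w\<close>. As \<open>1 / \<alpha> < \<alpha>\<close>, it vanishes, and its value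
at \<open>w = 0\<close> is \<open>E t \<sigma> * E s \<sigma>\<close>.

The hypothesis on the product only holds almost everywhere, while the argument needs it on whole lines. It is
therefore transferred to \<open>E\<close>, whose continuity along lines removes the exceptional points; passing through
rational \<open>\<tau>\<close> keeps the sets measurable when quantifiers are exchanged.\<close>

lemma fourier_decay_off_diagonal_decay_imp_zero:
  fixes h :: "('i \<Rightarrow> real) \<Rightarrow> complex" and \<alpha> C D :: real
  assumes I: "finite I" "i \<notin> I" and \<alpha>: "\<alpha> > 1" and h: "integrable (lborel_on (insert i I)) h"
    and ft: "AE \<omega> in lborel_on (insert i I).
        cmod (fourier_on (insert i I) h \<omega>) \<le> C * exp (- (pi * \<alpha> / 2) * (\<Sum>j\<in>insert i I. (\<omega> j)\<^sup>2))"
    and prod: "AE t in lborel_on (insert i I). AE s in lborel_on (insert i I).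
        cmod (h t) * cmod (h s) \<le> D * exp (- (pi * \<alpha>) * (t i - s i)\<^sup>2)"
  shows "AE t in lborel_on (insert i I). h t = 0"
proof -
  let ?K = "insert i I"
  have K: "finite ?K" using I by simp
  interpret K: sigma_finite_measure "lborel_on ?K" using K by (rule lborel_on.sigma_finite)
  interpret KK: pair_sigma_finite "lborel_on ?K" "lborel_on ?K" by standard
  interpret I: sigma_finite_measure "lborel_on I" using I(1) by (rule lborel_on.sigma_finite)
  interpret KI: pair_sigma_finite "lborel_on ?K" "lborel_on I" by standard
  interpret II: pair_sigma_finite "lborel_on I" "lborel_on I" by standard
  define k where "k = fourier_on ?K h"
  have [measurable]: "h \<in> borel_measurable (lborel_on ?K)" using h by auto
  have k_meas[measurable]: "k \<in> borel_measurable (lborel_on ?K)"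
    unfolding k_def by (rule borel_measurable_fourier_on[OF K]) auto
  have k_int: "integrable (lborel_on ?K) k"
    by (rule fourier_on_gaussian_bound(1)[OF K _ k_meas ft[folded k_def]]) (use \<alpha> in simp)
  define H where "H t = fourier_on ?K k (\<lambda>j. - t j)" for t
  have [measurable]: "H \<in> borel_measurable (lborel_on ?K)"
    unfolding H_def by (rule borel_measurable_fourier_on[OF K]) auto
  have hH: "AE t in lborel_on ?K. h t = H t"
    unfolding H_def k_def using fourier_on_inversion[OF K h] k_int k_def by simp
  \<comment> \<open>inverse transform in all coordinates except \<open>i\<close>, leaving a function of one frequency\<close>
  define \<kappa> where "\<kappa> t s = fourier_on I (\<lambda>x. k (x(i := s))) (\<lambda>j. - t j)" for t :: "'i \<Rightarrow> real" and s :: real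
  have \<kappa>_meas: "\<kappa> t \<in> borel_measurable borel" for t
  proof -
    have [measurable]: "(\<lambda>x. exp (- (\<i> * of_real (2 * pi * (\<Sum>j\<in>I. x j * - t j))))) \<in> borel_measurable (lborel_on I)"
      by (rule borel_measurable_phase)
    have [measurable]: "(\<lambda>z. k ((snd z)(i := fst z))) \<in> borel_measurable (borel \<Otimes>\<^sub>M lborel_on I)"
      by (rule measurable_compose[OF measurable_fun_upd[where J = I] k_meas]) auto
    show ?thesis unfolding \<kappa>_def fourier_on_def by measurable
  qed
  define G where "G = (LINT x|lborel_on I. exp (- (pi * \<alpha> / 2) * (\<Sum>j\<in>I. (x j)\<^sup>2)))"
  have \<kappa>_bound: "AE s in lborel. cmod (\<kappa> t s) \<le> C * G * exp (- (pi * \<alpha> / 2) * s\<^sup>2)" for t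
    using AE_lborel_on_insertD'[OF I ft]
  proof eventually_elim
    case (elim s)
    have le: "AE x in lborel_on I. cmod (k (x(i := s))) \<le> (C * exp (- (pi * \<alpha> / 2) * s\<^sup>2)) * exp (- (pi * \<alpha> / 2) * (\<Sum>j\<in>I. (x j)\<^sup>2))"
      using elim
    proof eventually_elim
      case (elim x)
      have "(\<Sum>j\<in>?K. ((x(i := s)) j)\<^sup>2) = s\<^sup>2 + (\<Sum>j\<in>I. (x j)\<^sup>2)"
        using I by (simp cong: sum.cong) (intro sum.cong, auto)
      then show ?case using elim unfolding k_def by (simp only: distrib_left exp_add mult.assoc)
    qed
    have "cmod (\<kappa> t s) \<le> (LINT x|lborel_on I. cmod (k (x(i := s)) * exp (- (\<i> * of_real (2 * pi * (\<Sum>j\<in>I. x j * - t j))))))"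
      unfolding \<kappa>_def fourier_on_def by (rule integral_norm_bound)
    also have "\<dots> = (LINT x|lborel_on I. cmod (k (x(i := s))))"
      by (simp only: norm_mult norm_exp_phase mult_1_right)
    also have "\<dots> \<le> (LINT x|lborel_on I. (C * exp (- (pi * \<alpha> / 2) * s\<^sup>2)) * exp (- (pi * \<alpha> / 2) * (\<Sum>j\<in>I. (x j)\<^sup>2)))"
    proof (rule integral_mono_AE')
      show "integrable (lborel_on I) (\<lambda>x. (C * exp (- (pi * \<alpha> / 2) * s\<^sup>2)) * exp (- (pi * \<alpha> / 2) * (\<Sum>j\<in>I. (x j)\<^sup>2)))"
        using \<alpha> by (intro integrable_mult_right gaussian_lborel_on I) auto
      show "AE x in lborel_on I. 0 \<le> (C * exp (- (pi * \<alpha> / 2) * s\<^sup>2)) * exp (- (pi * \<alpha> / 2) * (\<Sum>j\<in>I. (x j)\<^sup>2))"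
        using le by eventually_elim (rule order_trans[OF norm_ge_zero])
    qed (rule le)
    also have "\<dots> = C * G * exp (- (pi * \<alpha> / 2) * s\<^sup>2)"
      by (simp add: G_def)
    finally show ?case .
  qed
  define E where "E t \<tau> = (LINT s|lborel. \<kappa> t s * exp (\<i> * (of_real (2 * pi * s) * \<tau>)))" for t \<tau>
  define c where "c = C * G * (LINT \<omega>|lborel. exp (- (pi * \<alpha> / 2) * \<omega>\<^sup>2))"
  have E_hol: "E t holomorphic_on UNIV" and E_bound: "cmod (E t \<tau>) \<le> c * exp (2 * pi / \<alpha> * (Im \<tau>)\<^sup>2)" for t \<tau>
    unfolding E_def[abs_def] c_def
    using entire_fourier_gaussian[OF \<kappa>_meas _ \<kappa>_bound] \<alpha> by simp_all
  have HE: "H (t(i := \<tau>)) = E t (of_real \<tau>)" for t \<tau>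
  proof -
    have "(\<lambda>j. - (t(i := \<tau>)) j) = (\<lambda>j. - t j)(i := - \<tau>)" by auto
    then have "H (t(i := \<tau>)) = fourier_on ?K k ((\<lambda>j. - t j)(i := - \<tau>))" unfolding H_def by simp
    also have "\<dots> = E t (of_real \<tau>)"
      unfolding fourier_on_insert_rev[OF I k_int] E_def \<kappa>_def by (simp add: mult_ac)
    finally show ?thesis .
  qed
  have E_cont: "continuous_on UNIV (\<lambda>\<tau>::real. E t (of_real \<tau>))" for t
    by (rule continuous_on_compose2[OF holomorphic_on_imp_continuous_on[OF E_hol]]) (auto intro: continuous_intros)
  have [measurable]: "(\<lambda>z. H ((fst z)(i := \<tau>))) \<in> borel_measurable (lborel_on I \<Otimes>\<^sub>M M)" for \<tau> and M :: "('i \<Rightarrow> real) measure"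
    by (rule measurable_compose[OF measurable_fun_upd[where J = I]]) auto
  have [measurable]: "(\<lambda>z. H ((snd z)(i := \<tau>))) \<in> borel_measurable (M \<Otimes>\<^sub>M lborel_on I)" for \<tau> and M :: "('i \<Rightarrow> real) measure"
    by (rule measurable_compose[OF measurable_fun_upd[where J = I]]) auto
  have bound1: "AE w in lborel_on ?K. AE t in lborel_on ?K. cmod (H t) * cmod (H w) \<le> D * exp (- (pi * \<alpha>) * (t i - w i)\<^sup>2)"
  proof -
    have "AE t in lborel_on ?K. AE w in lborel_on ?K. cmod (H t) * cmod (H w) \<le> D * exp (- (pi * \<alpha>) * (t i - w i)\<^sup>2)"
      using prod hH
    proof eventually_elim
      case (elim t)
      from elim(1) hH show ?case by eventually_elim (use elim(2) in simp)
    qed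
    then show ?thesis by (rule KK.AE_commute[THEN iffD1, rotated]) measurable
  qed
  have bound2: "AE w in lborel_on ?K. AE t in lborel_on I.
      \<forall>\<tau>\<in>\<rat>. cmod (H (t(i := \<tau>))) * cmod (H w) \<le> D * exp (- (pi * \<alpha>) * (\<tau> - w i)\<^sup>2)"
    using bound1
  proof eventually_elim
    case (elim w)
    from AE_lborel_on_insertD[OF I elim] show ?case
    proof eventually_elim
      case (elim t)
      then have ae: "AE \<tau> in lborel. cmod (E t (of_real \<tau>)) * cmod (H w) \<le> D * exp (- (pi * \<alpha>) * (\<tau> - w i)\<^sup>2)"
        by (simp only: HE fun_upd_same)
      show ?case
        unfolding HE by (intro ballI AE_lborel_continuous_le[OF _ _ ae] continuous_intros E_cont)
    qed
  qed
  have "AE t in lborel_on I. AE w in lborel_on ?K.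
      \<forall>\<tau>\<in>\<rat>. cmod (H (t(i := \<tau>))) * cmod (H w) \<le> D * exp (- (pi * \<alpha>) * (\<tau> - w i)\<^sup>2)"
    using bound2 by (rule KI.AE_commute[THEN iffD1, rotated]) (use countable_rat in measurable)
  then have bound3: "AE t in lborel_on I. AE s in lborel_on I. \<forall>\<tau> \<sigma>::real.
      cmod (E t (of_real \<tau>)) * cmod (E s (of_real \<sigma>)) \<le> D * exp (- (pi * \<alpha>) * (\<tau> - \<sigma>)\<^sup>2)"
  proof eventually_elim
    case (elim t)
    from AE_lborel_on_insertD[OF I elim] show ?case
    proof eventually_elim
      case (elim s)
      have Q: "cmod (E t (of_real \<tau>)) * cmod (E s (of_real \<sigma>)) \<le> D * exp (- (pi * \<alpha>) * (\<tau> - \<sigma>)\<^sup>2)" if "\<tau> \<in> \<rat>" for \<tau> \<sigma>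
      proof -
        from elim have ae: "AE \<sigma> in lborel. cmod (E t (of_real \<tau>)) * cmod (E s (of_real \<sigma>)) \<le> D * exp (- (pi * \<alpha>) * (\<tau> - \<sigma>)\<^sup>2)"
          by eventually_elim (use that in \<open>simp only: HE fun_upd_same\<close>)
        show ?thesis by (intro AE_lborel_continuous_le[OF _ _ ae] continuous_intros E_cont)
      qed
      show ?case
      proof (intro allI)
        fix \<tau> \<sigma> :: real
        have "cmod (E t (of_real \<tau>)) * cmod (E s (of_real \<sigma>)) - D * exp (- (pi * \<alpha>) * (\<tau> - \<sigma>)\<^sup>2) \<le> 0"
          by (rule continuous_le_on_closure[where S = \<rat> and x = \<tau>
                and f = "\<lambda>\<tau>. cmod (E t (of_real \<tau>)) * cmod (E s (of_real \<sigma>)) - D * exp (- (pi * \<alpha>) * (\<tau> - \<sigma>)\<^sup>2)"])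
            (use Q in \<open>auto simp: Rats_closure_real intro!: continuous_intros E_cont\<close>)
        then show "cmod (E t (of_real \<tau>)) * cmod (E s (of_real \<sigma>)) \<le> D * exp (- (pi * \<alpha>) * (\<tau> - \<sigma>)\<^sup>2)" by simp
      qed
    qed
  qed
  have zero: "E t (of_real \<sigma>) * E s (of_real \<sigma>) = 0"
    if le: "\<forall>\<tau> \<sigma>::real. cmod (E t (of_real \<tau>)) * cmod (E s (of_real \<sigma>)) \<le> D * exp (- (pi * \<alpha>) * (\<tau> - \<sigma>)\<^sup>2)"
    for t s and \<sigma> :: real
  proof -
    define p where "p w = E t (of_real \<sigma> + w) * E s (of_real \<sigma> - w)" for w
    have c0: "c \<ge> 0" using order_trans[OF norm_ge_zero E_bound[of t 0]] by simp
    have "p 0 = 0"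
    proof (rule gaussian_growth_decay_imp_zero[where p = p and z = 0 and A = "4 * pi / \<alpha>" and B = "4 * pi * \<alpha>" and C = "max (c\<^sup>2) D"])
      have "(\<lambda>w. E t' (\<phi> w)) holomorphic_on UNIV" if "\<phi> holomorphic_on UNIV" for t' \<phi>
        using holomorphic_on_compose_gen[OF that E_hol subset_UNIV] by (simp only: o_def)
      then show "p holomorphic_on UNIV" unfolding p_def by (intro holomorphic_on_mult) (simp_all add: holomorphic_intros)
      show "0 \<le> 4 * pi / \<alpha>" using \<alpha> by simp
      have "1 < \<alpha> * \<alpha>" using \<alpha> by (simp add: less_1_mult)
      then show "4 * pi / \<alpha> < 4 * pi * \<alpha>" using \<alpha> by (simp add: field_simps)
    next
      fix z
      have "cmod (p z) \<le> (c * exp (2 * pi / \<alpha> * (Im (of_real \<sigma> + z))\<^sup>2)) * (c * exp (2 * pi / \<alpha> * (Im (of_real \<sigma> - z))\<^sup>2))"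
        unfolding p_def norm_mult using c0 by (intro mult_mono E_bound) auto
      also have "\<dots> = c\<^sup>2 * exp (4 * pi / \<alpha> * (Im z)\<^sup>2)"
        by (simp add: power2_eq_square mult_ac flip: exp_add)
      also have "\<dots> \<le> max (c\<^sup>2) D * exp (4 * pi / \<alpha> * (Im z)\<^sup>2)"
        by (intro mult_right_mono) auto
      finally show "cmod (p z) \<le> max (c\<^sup>2) D * exp (4 * pi / \<alpha> * (Im z)\<^sup>2)" .
    next
      fix u :: real
      have "cmod (p (of_real u)) = cmod (E t (of_real (\<sigma> + u))) * cmod (E s (of_real (\<sigma> - u)))"
        by (simp add: p_def norm_mult)
      also have "\<dots> \<le> D * exp (- (pi * \<alpha>) * ((\<sigma> + u) - (\<sigma> - u))\<^sup>2)" using le by blast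
      also have "- (pi * \<alpha>) * ((\<sigma> + u) - (\<sigma> - u))\<^sup>2 = - (4 * pi * \<alpha>) * u\<^sup>2"
        by (simp add: power2_eq_square)
      also have "D * exp (- (4 * pi * \<alpha>) * u\<^sup>2) \<le> max (c\<^sup>2) D * exp (- (4 * pi * \<alpha>) * u\<^sup>2)"
        by (intro mult_right_mono) auto
      finally show "cmod (p (of_real u)) \<le> max (c\<^sup>2) D * exp (- (4 * pi * \<alpha>) * u\<^sup>2)" by simp
    qed
    then show ?thesis by (simp add: p_def)
  qed
  have "AE t in lborel_on I. E t (of_real \<sigma>) = 0" for \<sigma>
  proof (rule AE_mult_self_eq_zero)
    show "AE t in lborel_on I. AE s in lborel_on I. E t (of_real \<sigma>) * E s (of_real \<sigma>) = 0"
      using bound3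
    proof eventually_elim
      case (elim t)
      then show ?case by eventually_elim (rule zero)
    qed
  qed
  then have "AE t in lborel_on I. \<forall>\<sigma>\<in>\<rat>. E t (of_real \<sigma>) = 0"
    using countable_rat by (subst AE_ball_countable) auto
  then have "AE t in lborel_on I. AE \<sigma> in lborel. H (t(i := \<sigma>)) = 0"
  proof eventually_elim
    case (elim t)
    have "E t (of_real \<sigma>) = 0" for \<sigma>
      by (rule continuous_constant_on_closure[of \<rat> "\<lambda>\<sigma>. E t (of_real \<sigma>)"])
        (use elim E_cont in \<open>auto simp: Rats_closure_real\<close>)
    then show ?case by (simp add: HE)
  qed
  from AE_lborel_on_insertI[OF I _ this] have "AE t in lborel_on ?K. H t = 0" by measurable
  with hH show ?thesis by eventually_elim simp
qed

section \<open>The uncertainty principle for the short-time Fourier transform\<close>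

lemma distr_lborel_on_affine:
  fixes c :: "'i \<Rightarrow> real" and a :: real
  assumes K: "finite K" and a: "\<bar>a\<bar> = 1"
  shows "distr (lborel_on K) (lborel_on K) (\<lambda>t. \<lambda>j\<in>K. c j + a * t j) = lborel_on K"
proof (rule lborel_on.PiM_eqI)
  have meas: "(\<lambda>t. \<lambda>j\<in>K. c j + a * t j) \<in> lborel_on K \<rightarrow>\<^sub>M lborel_on K" by measurable
  fix A :: "'i \<Rightarrow> real set" assume A: "\<And>i. i \<in> K \<Longrightarrow> A i \<in> sets lborel"
  have pre: "(\<lambda>x. c i + a * x) -` A i \<in> sets lborel" if "i \<in> K" for i
    using measurable_sets[of "\<lambda>x. c i + a * x" borel borel "A i"] A[OF that] by simp
  have em: "emeasure lborel ((\<lambda>x. c i + a * x) -` A i) = emeasure lborel (A i)" if "i \<in> K" for i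
  proof -
    have "a \<noteq> 0" using a by auto
    then have "lborel = distr lborel borel (\<lambda>x. c i + a * x)"
      using lborel_real_affine[of a "c i"] a by (simp add: density_1)
    then have "emeasure lborel (A i) = emeasure (distr lborel borel (\<lambda>x. c i + a * x)) (A i)" by simp
    also have "\<dots> = emeasure lborel ((\<lambda>x. c i + a * x) -` A i)"
      using A[OF that] by (subst emeasure_distr) auto
    finally show ?thesis by simp
  qed
  have "emeasure (distr (lborel_on K) (lborel_on K) (\<lambda>t. \<lambda>j\<in>K. c j + a * t j)) (Pi\<^sub>E K A)
      = emeasure (lborel_on K) ((\<lambda>t. \<lambda>j\<in>K. c j + a * t j) -` Pi\<^sub>E K A \<inter> space (lborel_on K))"
    by (rule emeasure_distr[OF meas]) (intro sets_PiM_I_finite K A)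
  also have "(\<lambda>t. \<lambda>j\<in>K. c j + a * t j) -` Pi\<^sub>E K A \<inter> space (lborel_on K) = (\<Pi>\<^sub>E i\<in>K. (\<lambda>x. c i + a * x) -` A i)"
    by (auto simp: space_PiM PiE_iff extensional_def)
  also have "emeasure (lborel_on K) \<dots> = (\<Prod>i\<in>K. emeasure lborel (A i))"
    using pre em by (subst lborel_on.emeasure_PiM[OF K]) auto
  finally show "emeasure (distr (lborel_on K) (lborel_on K) (\<lambda>t. \<lambda>j\<in>K. c j + a * t j)) (Pi\<^sub>E K A)
      = (\<Prod>i\<in>K. emeasure lborel (A i))" .
qed (use K in auto)

lemma AE_lborel_on_affine:
  assumes "finite K" "\<bar>a\<bar> = 1" "AE t in lborel_on K. P t"
  shows "AE t in lborel_on K. P (\<lambda>j\<in>K. c j + a * t j)"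
proof -
  have "(\<lambda>t. \<lambda>j\<in>K. c j + a * t j) \<in> lborel_on K \<rightarrow>\<^sub>M lborel_on K" by measurable
  from AE_distrD[OF this, of P] show ?thesis
    using assms(3) unfolding distr_lborel_on_affine[OF assms(1,2)] .
qed

lemma AE_lborel_on_shift:
  assumes "finite K" "AE t in lborel_on K. P t"
  shows "AE t in lborel_on K. P (\<lambda>j\<in>K. t j - x j)"
  using AE_lborel_on_affine[OF assms(1) _ assms(2), of 1 "\<lambda>j. - x j"] by simp

lemma AE_lborel_on_reflect:
  assumes "finite K" "AE x in lborel_on K. P (\<lambda>j\<in>K. t j - x j)"
  shows "AE s in lborel_on K. P s"
proof -
  have ae: "AE s in lborel_on K. P (\<lambda>j\<in>K. t j - (\<lambda>j\<in>K. t j + (-1) * s j) j)"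
    by (rule AE_lborel_on_affine[OF assms(1) _ assms(2)]) simp
  have "(\<lambda>j\<in>K. t j - (\<lambda>j\<in>K. t j + (-1) * s j) j) = s" if "s \<in> space (lborel_on K)" for s
    using that by (auto simp: space_PiM PiE_iff extensional_def)
  then show ?thesis by (intro AE_mp[OF ae AE_I2] impI) metis
qed

text \<open>The change of variables \<open>(x, t) \<mapsto> (t, t - x)\<close>. For fixed \<open>t\<close> it is a reflection in \<open>x\<close>, so it suffices to
exchange the quantifiers first.\<close>

lemma AE_lborel_on_shear:
  assumes K: "finite K"
    and R: "{z \<in> space (lborel_on K \<Otimes>\<^sub>M lborel_on K). R (fst z) (snd z)} \<in> sets (lborel_on K \<Otimes>\<^sub>M lborel_on K)"
    and AE: "AE x in lborel_on K. AE t in lborel_on K. R t (\<lambda>j\<in>K. t j - x j)"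
  shows "AE t in lborel_on K. AE s in lborel_on K. R t s"
proof -
  interpret sigma_finite_measure "lborel_on K" using K by (rule lborel_on.sigma_finite)
  interpret pair_sigma_finite "lborel_on K" "lborel_on K" by standard
  have "(\<lambda>z. (snd z, \<lambda>j\<in>K. snd z j - fst z j)) \<in> lborel_on K \<Otimes>\<^sub>M lborel_on K \<rightarrow>\<^sub>M lborel_on K \<Otimes>\<^sub>M lborel_on K"
    by measurable
  from measurable_sets_Collect[OF this R]
  have "{z \<in> space (lborel_on K \<Otimes>\<^sub>M lborel_on K). R (snd z) (\<lambda>j\<in>K. snd z j - fst z j)} \<in> sets (lborel_on K \<Otimes>\<^sub>M lborel_on K)"
    by simp
  then have "AE t in lborel_on K. AE x in lborel_on K. R t (\<lambda>j\<in>K. t j - x j)"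
    using AE_commute[of "\<lambda>x t. R t (\<lambda>j\<in>K. t j - x j)"] AE by simp
  then show ?thesis
    by eventually_elim (rule AE_lborel_on_reflect[OF K])
qed

text \<open>The short-time Fourier transform is, for each \<open>x\<close>, the Fourier transform of \<open>h x t = f t * cnj (g (t - x))\<close>.
Up to constant factors, inversion turns its decay into the bound \<open>exp (- (pi * \<alpha> / 2) * (x i)\<^sup>2)\<close> for \<open>h x\<close>, that is,
into the bound \<open>exp (- (pi * \<alpha> / 2) * (t i - s i)\<^sup>2)\<close> for \<open>f t * g s\<close>. The four factors of \<open>h x t * h x s\<close> can be
regrouped as \<open>f t * g (s - x)\<close> and \<open>f s * g (t - x)\<close>; each of these is small for \<open>t\<close> far from \<open>s\<close>, which gives the
off-diagonal decay with the rate \<open>pi * \<alpha>\<close>. Hence \<open>h x = 0\<close> for almost all \<open>x\<close>.\<close>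

theorem stft_hardy:
  fixes f g :: "('i \<Rightarrow> real) \<Rightarrow> complex" and \<alpha> C :: real
  assumes K: "finite K" "K \<noteq> {}" and \<alpha>: "\<alpha> > 1"
    and f[measurable]: "f \<in> borel_measurable (lborel_on K)" and f2: "integrable (lborel_on K) (\<lambda>t. (cmod (f t))\<^sup>2)"
    and g[measurable]: "g \<in> borel_measurable (lborel_on K)" and g2: "integrable (lborel_on K) (\<lambda>t. (cmod (g t))\<^sup>2)"
    and bound: "AE x in lborel_on K. AE \<omega> in lborel_on K.
        cmod (fourier_on K (\<lambda>t. f t * cnj (g (\<lambda>j\<in>K. t j - x j))) \<omega>)
          \<le> C * exp (- (pi * \<alpha> / 2) * ((\<Sum>j\<in>K. (x j)\<^sup>2) + (\<Sum>j\<in>K. (\<omega> j)\<^sup>2)))"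
  shows "(AE t in lborel_on K. f t = 0) \<or> (AE t in lborel_on K. g t = 0)"
proof -
  interpret sigma_finite_measure "lborel_on K" using K(1) by (rule lborel_on.sigma_finite)
  interpret pair_sigma_finite "lborel_on K" "lborel_on K" by standard
  obtain i where i: "i \<in> K" using K(2) by auto
  define I where "I = K - {i}"
  have I: "finite I" "i \<notin> I" "K = insert i I" using K(1) i by (auto simp: I_def)
  define h where "h x t = f t * cnj (g (\<lambda>j\<in>K. t j - x j))" for x t
  have norm_h: "cmod (h x t) = cmod (f t) * cmod (g (\<lambda>j\<in>K. t j - x j))" for x t
    by (simp add: h_def norm_mult)
  have shift_meas[measurable]: "(\<lambda>t. \<lambda>j\<in>K. t j - x j) \<in> lborel_on K \<rightarrow>\<^sub>M lborel_on K" for x :: "'i \<Rightarrow> real"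
    by measurable
  have h_int: "integrable (lborel_on K) (h x)" for x
  proof -
    have [measurable]: "(\<lambda>t. cnj (g (\<lambda>j\<in>K. t j - x j))) \<in> borel_measurable (lborel_on K)"
      by (rule measurable_compose[OF shift_meas]) (rule borel_measurable_continuous_on[OF _ g], intro continuous_intros)
    have "distr (lborel_on K) (lborel_on K) (\<lambda>t. \<lambda>j\<in>K. t j - x j) = lborel_on K"
      using distr_lborel_on_affine[OF K(1), of 1 "\<lambda>j. - x j"] by simp
    then have "integrable (lborel_on K) (\<lambda>t. (cmod (g (\<lambda>j\<in>K. t j - x j)))\<^sup>2)"
      using integrable_distr[OF shift_meas[of x], of "\<lambda>t. (cmod (g t))\<^sup>2"] g2 by simp
    then have "integrable (lborel_on K) (\<lambda>t. (cmod (f t))\<^sup>2 + (cmod (g (\<lambda>j\<in>K. t j - x j)))\<^sup>2)"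
      using f2 by simp
    then show ?thesis
    proof (rule Bochner_Integration.integrable_bound)
      show "h x \<in> borel_measurable (lborel_on K)" unfolding h_def by measurable
      have "a * b \<le> a\<^sup>2 + b\<^sup>2" for a b :: real
      proof -
        have "2 * (a * b) \<le> a\<^sup>2 + b\<^sup>2" using sum_squares_bound[of a b] by (simp only: mult.assoc)
        then show ?thesis using zero_le_power2[of a] zero_le_power2[of b] by linarith
      qed
      then show "AE t in lborel_on K. cmod (h x t) \<le> norm ((cmod (f t))\<^sup>2 + (cmod (g (\<lambda>j\<in>K. t j - x j)))\<^sup>2)"
        unfolding norm_h by (intro AE_I2) simp
    qed
  qed
  define G where "G = (LINT \<omega>|lborel_on K. exp (- (pi * \<alpha> / 2) * (\<Sum>j\<in>K. (\<omega> j)\<^sup>2)))"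
  have G: "G \<ge> 0" unfolding G_def by (intro integral_nonneg_AE) auto
  define C1 where "C1 = \<bar>C\<bar> * G"
  have C1: "C1 \<ge> 0" using G by (simp add: C1_def)
  have bound': "AE x in lborel_on K. AE \<omega> in lborel_on K. cmod (fourier_on K (h x) \<omega>)
      \<le> (\<bar>C\<bar> * exp (- (pi * \<alpha> / 2) * (x i)\<^sup>2)) * exp (- (pi * \<alpha> / 2) * (\<Sum>j\<in>K. (\<omega> j)\<^sup>2))"
    using bound
  proof eventually_elim
    case (elim x)
    have le: "(x i)\<^sup>2 \<le> (\<Sum>j\<in>K. (x j)\<^sup>2)" using K(1) i by (intro member_le_sum) auto
    from elim show ?case
    proof eventually_elim
      case (elim \<omega>)
      have "cmod (fourier_on K (h x) \<omega>) \<le> C * exp (- (pi * \<alpha> / 2) * ((\<Sum>j\<in>K. (x j)\<^sup>2) + (\<Sum>j\<in>K. (\<omega> j)\<^sup>2)))"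
        using elim unfolding h_def .
      also have "\<dots> \<le> \<bar>C\<bar> * exp (- (pi * \<alpha> / 2) * ((x i)\<^sup>2 + (\<Sum>j\<in>K. (\<omega> j)\<^sup>2)))"
        using le \<alpha> by (intro mult_mono) auto
      finally show ?case by (simp only: distrib_left exp_add mult.assoc)
    qed
  qed
  have ptw: "AE x in lborel_on K. AE t in lborel_on K. cmod (h x t) \<le> C1 * exp (- (pi * \<alpha> / 2) * (x i)\<^sup>2)"
    using bound'
  proof eventually_elim
    case (elim x)
    have meas: "fourier_on K (h x) \<in> borel_measurable (lborel_on K)"
      using h_int[of x] by (intro borel_measurable_fourier_on K(1)) auto
    note * = fourier_on_gaussian_bound[OF K(1) _ meas elim, of]
    have "integrable (lborel_on K) (fourier_on K (h x))" using * \<alpha> by simp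
    from fourier_on_inversion[OF K(1) h_int this] show ?case
    proof eventually_elim
      case (elim t)
      then show ?case using *(2)[of "\<lambda>j. - t j"] \<alpha> by (simp add: C1_def G_def mult_ac)
    qed
  qed
  have B: "AE t in lborel_on K. AE s in lborel_on K. cmod (f t) * cmod (g s) \<le> C1 * exp (- (pi * \<alpha> / 2) * (t i - s i)\<^sup>2)"
  proof (rule AE_lborel_on_shear[OF K(1)])
    show "AE x in lborel_on K. AE t in lborel_on K. cmod (f t) * cmod (g (\<lambda>j\<in>K. t j - x j))
        \<le> C1 * exp (- (pi * \<alpha> / 2) * (t i - (\<lambda>j\<in>K. t j - x j) i)\<^sup>2)"
      using ptw i unfolding norm_h by simp
  qed (use i in measurable)
  have B': "AE s in lborel_on K. AE t in lborel_on K. cmod (f t) * cmod (g s) \<le> C1 * exp (- (pi * \<alpha> / 2) * (t i - s i)\<^sup>2)"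
    using B by (rule AE_commute[THEN iffD1, rotated]) (use i in measurable)
  have prod: "AE t in lborel_on K. AE s in lborel_on K. cmod (h x t) * cmod (h x s) \<le> C1\<^sup>2 * exp (- (pi * \<alpha>) * (t i - s i)\<^sup>2)" for x
  proof -
    have "AE t in lborel_on K. AE s in lborel_on K.
        cmod (f s) * cmod (g (\<lambda>j\<in>K. t j - x j)) \<le> C1 * exp (- (pi * \<alpha> / 2) * (s i - (\<lambda>j\<in>K. t j - x j) i)\<^sup>2)"
      by (rule AE_lborel_on_shift[OF K(1) B'])
    then show ?thesis using B
    proof eventually_elim
      case (elim t)
      from elim(1) AE_lborel_on_shift[OF K(1) elim(2), of x] show ?case
      proof eventually_elim
        case (elim s)
        have "cmod (h x t) * cmod (h x s) = (cmod (f t) * cmod (g (\<lambda>j\<in>K. s j - x j))) * (cmod (f s) * cmod (g (\<lambda>j\<in>K. t j - x j)))"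
          by (simp add: norm_h)
        also have "\<dots> \<le> (C1 * exp (- (pi * \<alpha> / 2) * (t i - (s i - x i))\<^sup>2)) * (C1 * exp (- (pi * \<alpha> / 2) * (s i - (t i - x i))\<^sup>2))"
          using elim i C1 by - (rule mult_mono, simp_all)
        also have "\<dots> = C1\<^sup>2 * exp (- (pi * \<alpha> / 2) * (t i - (s i - x i))\<^sup>2 + - (pi * \<alpha> / 2) * (s i - (t i - x i))\<^sup>2)"
          by (simp only: exp_add power2_eq_square[of C1] mult_ac)
        also have "- (pi * \<alpha> / 2) * (t i - (s i - x i))\<^sup>2 + - (pi * \<alpha> / 2) * (s i - (t i - x i))\<^sup>2
            = - (pi * \<alpha>) * (t i - s i)\<^sup>2 - pi * \<alpha> * (x i)\<^sup>2"
          by (simp add: power2_eq_square field_simps)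
        also have "C1\<^sup>2 * exp \<dots> \<le> C1\<^sup>2 * exp (- (pi * \<alpha>) * (t i - s i)\<^sup>2)"
          using \<alpha> by (intro mult_left_mono) auto
        finally show ?case .
      qed
    qed
  qed
  have "AE x in lborel_on K. AE t in lborel_on K. h x t = 0"
    using bound'
  proof eventually_elim
    case (elim x)
    show ?case
      using fourier_decay_off_diagonal_decay_imp_zero[OF I(1,2) \<alpha>, folded I(3), OF h_int elim prod] .
  qed
  then have "AE x in lborel_on K. AE t in lborel_on K. f t = 0 \<or> g (\<lambda>j\<in>K. t j - x j) = 0"
    unfolding h_def by simp
  then have "AE t in lborel_on K. AE s in lborel_on K. f t = 0 \<or> g s = 0"
    by (rule AE_lborel_on_shear[OF K(1), rotated]) measurable
  then show ?thesis by (rule AE_disj_separate)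
qed

section \<open>Slicing Lebesgue measure on phase space\<close>

lemma prod_Basis_vec: "(\<Prod>b\<in>Basis. (x :: real ^ 'n::finite) \<bullet> b) = (\<Prod>i\<in>UNIV. x $ i)"
proof -
  have B: "(Basis :: (real ^ 'n) set) = range (\<lambda>i. axis i 1)" by (auto simp: Basis_vec_def)
  have inj: "inj (\<lambda>i :: 'n. axis i (1 :: real))" by (simp add: inj_on_def axis_eq_axis)
  show ?thesis unfolding B prod.reindex[OF inj] by (simp add: inner_axis)
qed

lemma borel_measurable_vec_lambda:
  fixes f :: "'a \<Rightarrow> 'n::finite \<Rightarrow> real"
  assumes "\<And>i. (\<lambda>x. f x i) \<in> borel_measurable M"
  shows "(\<lambda>x. \<chi> i. f x i) \<in> borel_measurable M"
  unfolding borel_measurable_euclidean_space[of "\<lambda>x. \<chi> i. f x i"]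
  using assms by (auto simp: Basis_vec_def inner_axis)

lemma distr_eq_lborel_vec:
  fixes \<phi> :: "'a \<Rightarrow> real ^ 'n::finite"
  assumes \<phi>: "\<phi> \<in> borel_measurable M"
    and box: "\<And>l u :: 'n \<Rightarrow> real. (\<And>i. l i \<le> u i) \<Longrightarrow>
      emeasure M {z \<in> space M. \<forall>i. l i < \<phi> z $ i \<and> \<phi> z $ i < u i} = (\<Prod>i\<in>UNIV. ennreal (u i - l i))"
  shows "distr M borel \<phi> = lborel"
proof (rule lborel_eqI[symmetric])
  fix l u :: "real ^ 'n" assume "\<And>b. b \<in> Basis \<Longrightarrow> l \<bullet> b \<le> u \<bullet> b"
  from this[OF axis_in_Basis_iff[THEN iffD2]] have le: "l $ i \<le> u $ i" for i by (simp add: inner_axis)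
  have "emeasure (distr M borel \<phi>) (box l u) = emeasure M (\<phi> -` box l u \<inter> space M)"
    by (rule emeasure_distr[OF \<phi>]) simp
  also have "\<phi> -` box l u \<inter> space M = {z \<in> space M. \<forall>i. l $ i < \<phi> z $ i \<and> \<phi> z $ i < u $ i}"
    by (auto simp: mem_box_cart)
  also have "emeasure M \<dots> = (\<Prod>i\<in>UNIV. ennreal (u $ i - l $ i))" by (rule box[OF le])
  also have "\<dots> = ennreal (\<Prod>b\<in>Basis. (u - l) \<bullet> b)"
    unfolding prod_Basis_vec using le by (simp add: prod_ennreal)
  finally show "emeasure (distr M borel \<phi>) (box l u) = ennreal (\<Prod>b\<in>Basis. (u - l) \<bullet> b)" .
qed simp

lemma emeasure_lborel_on_box:
  fixes l u :: "'i \<Rightarrow> real"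
  assumes "finite I" "\<And>i. i \<in> I \<Longrightarrow> l i \<le> u i"
  shows "emeasure (lborel_on I) (\<Pi>\<^sub>E i\<in>I. {l i<..<u i}) = (\<Prod>i\<in>I. ennreal (u i - l i))"
  using assms by (subst lborel_on.emeasure_PiM) auto

definition glue :: "'i set \<Rightarrow> ('i \<Rightarrow> real) \<Rightarrow> ('i \<Rightarrow> real) \<Rightarrow> real ^ 'i::finite" where
  "glue K t y = (\<chi> i. if i \<in> K then t i else y i)"

lemma measurable_glue: "(\<lambda>z. glue K (snd z) (fst z)) \<in> borel_measurable (lborel_on (- K) \<Otimes>\<^sub>M lborel_on K)"
  unfolding glue_def
proof (rule borel_measurable_vec_lambda)
  fix i
  show "(\<lambda>z. if i \<in> K then snd z i else fst z i) \<in> borel_measurable (lborel_on (- K) \<Otimes>\<^sub>M lborel_on K)"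
    by (cases "i \<in> K") (auto intro!: measurable_compose[OF measurable_snd] measurable_compose[OF measurable_fst])
qed

lemma prod_split_Compl:
  fixes f :: "'i::finite \<Rightarrow> 'b::comm_monoid_mult"
  shows "(\<Prod>i\<in>UNIV. f i) = (\<Prod>i\<in>-K. f i) * (\<Prod>i\<in>K. f i)"
  by (subst prod.union_disjoint[symmetric]) (auto simp: Un_commute)

lemma distr_glue:
  "distr (lborel_on (- K) \<Otimes>\<^sub>M lborel_on K) borel (\<lambda>z. glue K (snd z) (fst z)) = lborel"
proof (rule distr_eq_lborel_vec[OF measurable_glue])
  interpret sigma_finite_measure "lborel_on K" by (intro lborel_on.sigma_finite) simp
  fix l u :: "'a \<Rightarrow> real" assume le: "\<And>i. l i \<le> u i"
  have "{z \<in> space (lborel_on (- K) \<Otimes>\<^sub>M lborel_on K). \<forall>i. l i < glue K (snd z) (fst z) $ i \<and> glue K (snd z) (fst z) $ i < u i}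
      = (\<Pi>\<^sub>E i\<in>-K. {l i<..<u i}) \<times> (\<Pi>\<^sub>E i\<in>K. {l i<..<u i})"
    by (auto simp: glue_def space_pair_measure space_PiM PiE_iff split: if_splits)
  then show "emeasure (lborel_on (- K) \<Otimes>\<^sub>M lborel_on K) {z \<in> space (lborel_on (- K) \<Otimes>\<^sub>M lborel_on K).
      \<forall>i. l i < glue K (snd z) (fst z) $ i \<and> glue K (snd z) (fst z) $ i < u i} = (\<Prod>i\<in>UNIV. ennreal (u i - l i))"
    using le by (simp add: emeasure_pair_measure_Times sets_PiM_I_finite emeasure_lborel_on_box prod_split_Compl[of _ K])
qed

text \<open>Assembles a point of phase space from the coordinates outside \<open>K\<close>, which are parameters of the partial transform,
and the coordinates in \<open>K\<close>. The sign in the last line compensates the reflection in the definition of the partial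
short-time Fourier transform, so that the second parameter is the argument of the window itself.\<close>

definition phase_glue :: "'d set \<Rightarrow> (('d \<Rightarrow> real) \<times> ('d \<Rightarrow> real)) \<times> (('d \<Rightarrow> real) \<times> ('d \<Rightarrow> real)) \<Rightarrow> real ^ ('d::finite + 'd)" where
  "phase_glue K p = (\<chi> j. case j of
      Inl i \<Rightarrow> if i \<in> K then fst (snd p) i else fst (fst p) i
    | Inr i \<Rightarrow> if i \<in> K then snd (snd p) i else - snd (fst p) i)"

lemma measurable_phase_glue:
  "phase_glue K \<in> borel_measurable ((lborel_on (- K) \<Otimes>\<^sub>M lborel_on (- K)) \<Otimes>\<^sub>M (lborel_on K \<Otimes>\<^sub>M lborel_on K))"
    (is "_ \<in> borel_measurable ?M")
  unfolding phase_glue_def[abs_def]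
proof (rule borel_measurable_vec_lambda)
  fix j :: "'a + 'a"
  have [measurable]: "(\<lambda>p. fst (snd p) i) \<in> borel_measurable ?M" "(\<lambda>p. snd (snd p) i) \<in> borel_measurable ?M" if "i \<in> K" for i
    using that by measurable
  have [measurable]: "(\<lambda>p. fst (fst p) i) \<in> borel_measurable ?M" "(\<lambda>p. snd (fst p) i) \<in> borel_measurable ?M" if "i \<in> - K" for i
    using that by measurable
  show "(\<lambda>p. case j of
      Inl i \<Rightarrow> if i \<in> K then fst (snd p) i else fst (fst p) i
    | Inr i \<Rightarrow> if i \<in> K then snd (snd p) i else - snd (fst p) i) \<in> borel_measurable ?M"
  proof (cases j)
    case (Inl i)
    then show ?thesis by (cases "i \<in> K") simp_all
  next
    case (Inr i)
    then show ?thesis by (cases "i \<in> K") (simp_all add: borel_measurable_uminus)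
  qed
qed

lemma distr_phase_glue:
  "distr ((lborel_on (- K) \<Otimes>\<^sub>M lborel_on (- K)) \<Otimes>\<^sub>M (lborel_on K \<Otimes>\<^sub>M lborel_on K)) borel (phase_glue K) = lborel"
    (is "distr ?M _ _ = _")
proof (rule distr_eq_lborel_vec[OF measurable_phase_glue])
  interpret K: sigma_finite_measure "lborel_on K" by (intro lborel_on.sigma_finite) simp
  interpret N: sigma_finite_measure "lborel_on (- K)" by (intro lborel_on.sigma_finite) simp
  interpret KK: pair_sigma_finite "lborel_on K" "lborel_on K" by standard
  fix l u :: "'a + 'a \<Rightarrow> real" assume le: "\<And>j. l j \<le> u j"
  let ?a = "\<Pi>\<^sub>E i\<in>-K. {l (Inl i)<..<u (Inl i)}" and ?b = "\<Pi>\<^sub>E i\<in>-K. {- u (Inr i)<..<- l (Inr i)}"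
    and ?c = "\<Pi>\<^sub>E i\<in>K. {l (Inl i)<..<u (Inl i)}" and ?d = "\<Pi>\<^sub>E i\<in>K. {l (Inr i)<..<u (Inr i)}"
  have "{p \<in> space ?M. \<forall>j. l j < phase_glue K p $ j \<and> phase_glue K p $ j < u j} = (?a \<times> ?b) \<times> (?c \<times> ?d)"
  proof (rule set_eqI)
    fix p :: "(('a \<Rightarrow> real) \<times> ('a \<Rightarrow> real)) \<times> (('a \<Rightarrow> real) \<times> ('a \<Rightarrow> real))"
    obtain y y' x w where p: "p = ((y, y'), (x, w))" by (metis surj_pair)
    have "(\<forall>j. l j < phase_glue K p $ j \<and> phase_glue K p $ j < u j) \<longleftrightarrow>
      (\<forall>i\<in>-K. l (Inl i) < y i \<and> y i < u (Inl i)) \<and> (\<forall>i\<in>-K. - u (Inr i) < y' i \<and> y' i < - l (Inr i)) \<and>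
      (\<forall>i\<in>K. l (Inl i) < x i \<and> x i < u (Inl i)) \<and> (\<forall>i\<in>K. l (Inr i) < w i \<and> w i < u (Inr i))"
      unfolding p phase_glue_def split_sum_all by (auto simp: minus_less_iff less_minus_iff split: if_splits)
    then show "p \<in> {p \<in> space ?M. \<forall>j. l j < phase_glue K p $ j \<and> phase_glue K p $ j < u j} \<longleftrightarrow> p \<in> (?a \<times> ?b) \<times> (?c \<times> ?d)"
      by (auto simp: p space_pair_measure space_PiM PiE_iff)
  qed
  moreover have "emeasure ?M ((?a \<times> ?b) \<times> (?c \<times> ?d))
      = (emeasure (lborel_on (- K)) ?a * emeasure (lborel_on (- K)) ?b) * (emeasure (lborel_on K) ?c * emeasure (lborel_on K) ?d)"
  proof -
    have sets: "?a \<in> sets (lborel_on (- K))" "?b \<in> sets (lborel_on (- K))" "?c \<in> sets (lborel_on K)" "?d \<in> sets (lborel_on K)"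
      by (auto intro!: sets_PiM_I_finite)
    have "sigma_finite_measure (lborel_on K \<Otimes>\<^sub>M lborel_on K)" by (rule KK.sigma_finite_measure_axioms)
    from sigma_finite_measure.emeasure_pair_measure_Times[OF this, of "?a \<times> ?b" "lborel_on (- K) \<Otimes>\<^sub>M lborel_on (- K)" "?c \<times> ?d"]
    show ?thesis using sets by (simp add: K.emeasure_pair_measure_Times N.emeasure_pair_measure_Times)
  qed
  moreover have "emeasure (lborel_on (- K)) ?b = (\<Prod>i\<in>-K. ennreal (u (Inr i) - l (Inr i)))"
    using le by (subst emeasure_lborel_on_box) auto
  moreover have "(\<Prod>j\<in>UNIV. ennreal (u j - l j)) =
      (\<Prod>i\<in>UNIV. ennreal (u (Inl i) - l (Inl i))) * (\<Prod>i\<in>UNIV. ennreal (u (Inr i) - l (Inr i)))"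
    unfolding UNIV_Plus_UNIV[symmetric] by (subst prod.Plus) auto
  ultimately show "emeasure ?M {p \<in> space ?M. \<forall>j. l j < phase_glue K p $ j \<and> phase_glue K p $ j < u j}
      = (\<Prod>j\<in>UNIV. ennreal (u j - l j))"
    using le by (simp add: emeasure_lborel_on_box prod_split_Compl[of _ K] mult_ac)
qed

lemma borel_representative:
  fixes f :: "real ^ 'n::finite \<Rightarrow> complex"
  assumes "f \<in> borel_measurable lebesgue"
  obtains f0 where "f0 \<in> borel_measurable borel" "AE x in lborel. f x = f0 x"
proof -
  have "(\<lambda>x. Re (f x)) \<in> borel_measurable (completion lborel)" "(\<lambda>x. Im (f x)) \<in> borel_measurable (completion lborel)"
    using assms by measurable
  from this[THEN completion_ex_borel_measurable_real]
  obtain r s where r: "r \<in> borel_measurable lborel" "AE x in lborel. Re (f x) = r x"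
    and s: "s \<in> borel_measurable lborel" "AE x in lborel. Im (f x) = s x"
    by blast
  show thesis
  proof
    show "(\<lambda>x. Complex (r x) (s x)) \<in> borel_measurable borel"
      using r(1) s(1) unfolding Complex_eq by measurable
    show "AE x in lborel. f x = Complex (r x) (s x)"
      using r(2) s(2) by eventually_elim (simp add: complex_eq_iff)
  qed
qed

text \<open>Slices of Lebesgue measurable functions are measurable for the completed product measure only. This replaces them
by slices of Borel functions; \<open>u\<close> is measurable because null sets of the completion are closed under subsets.\<close>

lemma integral_completion_AE_eq:
  fixes u v :: "'a \<Rightarrow> 'b::{banach, second_countable_topology}"
  assumes v: "v \<in> borel_measurable M" and eq: "AE x in M. u x = v x"
  shows "integral\<^sup>L (completion M) u = integral\<^sup>L M v"
proof -
  have eq': "AE x in completion M. u x = v x" using eq by (rule AE_completion)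
  have v': "v \<in> borel_measurable (completion M)" using v by (rule measurable_completion)
  have "u \<in> borel_measurable (completion M)"
  proof (rule measurableI)
    fix A :: "'b set" assume "A \<in> sets borel"
    then have sets: "v -` A \<inter> space (completion M) \<in> sets (completion M)" using v' by (rule measurable_sets[rotated])
    have ae: "AE x in completion M. x \<in> v -` A \<inter> space (completion M) \<longleftrightarrow> x \<in> u -` A \<inter> space (completion M)"
      using eq' by eventually_elim simp
    show "u -` A \<inter> space (completion M) \<in> sets (completion M)"
      by (rule completion.in_sets_AE[OF ae sets]) auto
  qed simp
  then have "integral\<^sup>L (completion M) u = integral\<^sup>L (completion M) v"
    by (rule integral_cong_AE[OF _ v' eq'])
  also have "\<dots> = integral\<^sup>L M v" by (rule integral_completion[OF v])
  finally show ?thesis .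
qed

lemma AE_glueD:
  assumes "AE x in lborel. P x"
  shows "AE y in lborel_on (- K). AE t in lborel_on K. P (glue K t y)"
proof -
  interpret K: sigma_finite_measure "lborel_on K" by (intro lborel_on.sigma_finite) simp
  interpret N: sigma_finite_measure "lborel_on (- K)" by (intro lborel_on.sigma_finite) simp
  interpret pair_sigma_finite "lborel_on (- K)" "lborel_on K" by standard
  have "AE z in lborel_on (- K) \<Otimes>\<^sub>M lborel_on K. P (glue K (snd z) (fst z))"
    using AE_distrD[OF measurable_glue, of P K] assms unfolding distr_glue by simp
  from AE_pair[OF this] show ?thesis by simp
qed

lemma AE_glueI:
  assumes P: "{x \<in> space borel. P x} \<in> sets borel"
    and AE: "AE y in lborel_on (- K). AE t in lborel_on K. P (glue K t y)"
  shows "AE x in lborel. P x"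
proof -
  interpret K: sigma_finite_measure "lborel_on K" by (intro lborel_on.sigma_finite) simp
  interpret N: sigma_finite_measure "lborel_on (- K)" by (intro lborel_on.sigma_finite) simp
  interpret pair_sigma_finite "lborel_on (- K)" "lborel_on K" by standard
  have "AE z in lborel_on (- K) \<Otimes>\<^sub>M lborel_on K. P (glue K (snd z) (fst z))"
    by (rule AE_pair_measure) (use AE measurable_sets_Collect[OF measurable_glue P] in simp_all)
  then have "AE x in distr (lborel_on (- K) \<Otimes>\<^sub>M lborel_on K) borel (\<lambda>z. glue K (snd z) (fst z)). P x"
    by (subst AE_distr_iff[OF measurable_glue P])
  then show ?thesis unfolding distr_glue .
qed

lemma AE_phase_glueD:
  assumes "AE z in lborel. P z"
  shows "AE y in lborel_on (- K). AE y' in lborel_on (- K). AE x in lborel_on K. AE \<omega> in lborel_on K.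
      P (phase_glue K ((y, y'), (x, \<omega>)))"
proof -
  interpret K: sigma_finite_measure "lborel_on K" by (intro lborel_on.sigma_finite) simp
  interpret N: sigma_finite_measure "lborel_on (- K)" by (intro lborel_on.sigma_finite) simp
  interpret KK: pair_sigma_finite "lborel_on K" "lborel_on K" by standard
  interpret NN: pair_sigma_finite "lborel_on (- K)" "lborel_on (- K)" by standard
  interpret pair_sigma_finite "lborel_on (- K) \<Otimes>\<^sub>M lborel_on (- K)" "lborel_on K \<Otimes>\<^sub>M lborel_on K"
    by (intro pair_sigma_finite.intro KK.sigma_finite_measure_axioms NN.sigma_finite_measure_axioms)
  have "AE p in (lborel_on (- K) \<Otimes>\<^sub>M lborel_on (- K)) \<Otimes>\<^sub>M (lborel_on K \<Otimes>\<^sub>M lborel_on K). P (phase_glue K p)"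
    using AE_distrD[OF measurable_phase_glue, of P K] assms unfolding distr_phase_glue by simp
  from NN.AE_pair[OF AE_pair[OF this]] show ?thesis
    by eventually_elim (auto elim!: eventually_mono dest!: KK.AE_pair)
qed

section \<open>The partial short-time Fourier transform\<close>

text \<open>With the coordinates outside \<open>K\<close> frozen, the partial transform is the short-time Fourier transform on \<open>\<real>\<^sup>K\<close> of
the slices of \<open>F\<close> and \<open>G\<close>, which may be replaced by slices of their Borel representatives \<open>F0\<close> and \<open>G0\<close>. This
holds for every \<open>x\<close>, since translations preserve null sets.\<close>

lemma partial_stft_phase_glue:
  fixes F G F0 G0 :: "real ^ 'd::{finite,linorder} \<Rightarrow> complex" and k :: nat
  defines "K \<equiv> first_coords k"
  assumes [measurable]: "F0 \<in> borel_measurable borel" "G0 \<in> borel_measurable borel"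
    and F: "AE t in lborel_on K. F (glue K t y) = F0 (glue K t y)"
    and G: "AE t in lborel_on K. G (glue K t y') = G0 (glue K t y')"
    and y: "y \<in> space (lborel_on (- K))" "y' \<in> space (lborel_on (- K))"
  shows "partial_stft k G F (phase_glue K ((y, y'), (x, \<omega>)))
      = fourier_on K (\<lambda>t. F0 (glue K t y) * cnj (G0 (glue K (\<lambda>j\<in>K. t j - x j) y'))) \<omega>"
proof -
  define z where "z = phase_glue K ((y, y'), (x, \<omega>))"
  have K: "finite K" by simp
  have z1: "fst_part z $ i = (if i \<in> K then x i else y i)" and z2: "snd_part z $ i = (if i \<in> K then \<omega> i else - y' i)" for i
    by (simp_all add: z_def phase_glue_def fst_part_def snd_part_def)
  have "partial_stft k G F z = (LINT t|completion (lborel_on K).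
      F (glue K t y) * cnj (G (glue K (\<lambda>j\<in>K. t j - x j) y')) * exp (- (\<i> * of_real (2 * pi * (\<Sum>i\<in>K. t i * \<omega> i)))))"
    unfolding partial_stft_def Let_def K_def[symmetric]
  proof (intro Bochner_Integration.integral_cong refl)
    fix t
    have "(\<chi> i. if i \<in> K then t i else fst_part z $ i) = glue K t y" by (simp add: glue_def z1 vec_eq_iff)
    moreover have "(\<chi> i. if i \<in> K then t i - fst_part z $ i else - snd_part z $ i) = glue K (\<lambda>j\<in>K. t j - x j) y'"
      by (simp add: glue_def z1 z2 vec_eq_iff)
    moreover have "(\<Sum>i\<in>K. t i * snd_part z $ i) = (\<Sum>i\<in>K. t i * \<omega> i)" by (simp add: z2)
    ultimately show "F (\<chi> i. if i \<in> K then t i else fst_part z $ i)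
        * cnj (G (\<chi> i. if i \<in> K then t i - fst_part z $ i else - snd_part z $ i))
        * exp (- (\<i> * of_real (2 * pi * (\<Sum>i\<in>K. t i * snd_part z $ i))))
      = F (glue K t y) * cnj (G (glue K (\<lambda>j\<in>K. t j - x j) y')) * exp (- (\<i> * of_real (2 * pi * (\<Sum>i\<in>K. t i * \<omega> i))))"
      by (simp only:)
  qed
  also have "\<dots> = fourier_on K (\<lambda>t. F0 (glue K t y) * cnj (G0 (glue K (\<lambda>j\<in>K. t j - x j) y'))) \<omega>"
    unfolding fourier_on_def
  proof (rule integral_completion_AE_eq)
    have [measurable]: "(\<lambda>t. glue K t y0) \<in> lborel_on K \<rightarrow>\<^sub>M borel" if "y0 \<in> space (lborel_on (- K))" for y0
      using measurable_compose[OF measurable_Pair1'[OF that] measurable_glue[of K]] by simp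
    have [measurable]: "(\<lambda>t. exp (- (\<i> * of_real (2 * pi * (\<Sum>i\<in>K. t i * \<omega> i))))) \<in> borel_measurable (lborel_on K)"
      by (rule borel_measurable_phase)
    have [measurable]: "(\<lambda>t. F0 (glue K t y)) \<in> borel_measurable (lborel_on K)" using y by measurable
    have G0: "(\<lambda>t. G0 (glue K t y')) \<in> borel_measurable (lborel_on K)" using y by measurable
    have [measurable]: "(\<lambda>t. cnj (G0 (glue K (\<lambda>j\<in>K. t j - x j) y'))) \<in> borel_measurable (lborel_on K)"
    proof (rule measurable_compose[where g = "\<lambda>t. cnj (G0 (glue K t y'))" and N = "lborel_on K"])
      show "(\<lambda>t. \<lambda>j\<in>K. t j - x j) \<in> lborel_on K \<rightarrow>\<^sub>M lborel_on K" by measurable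
      show "(\<lambda>t. cnj (G0 (glue K t y'))) \<in> borel_measurable (lborel_on K)"
        by (rule borel_measurable_continuous_on[OF _ G0]) (intro continuous_intros)
    qed
    show "(\<lambda>t. F0 (glue K t y) * cnj (G0 (glue K (\<lambda>j\<in>K. t j - x j) y')) *
        exp (- (\<i> * of_real (2 * pi * (\<Sum>i\<in>K. t i * \<omega> i))))) \<in> borel_measurable (lborel_on K)" by measurable
    show "AE t in lborel_on K. F (glue K t y) * cnj (G (glue K (\<lambda>j\<in>K. t j - x j) y')) * exp (- (\<i> * of_real (2 * pi * (\<Sum>i\<in>K. t i * \<omega> i))))
        = F0 (glue K t y) * cnj (G0 (glue K (\<lambda>j\<in>K. t j - x j) y')) * exp (- (\<i> * of_real (2 * pi * (\<Sum>i\<in>K. t i * \<omega> i))))"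
      using F AE_lborel_on_shift[OF K G, of x] by eventually_elim (simp only:)
  qed
  finally show ?thesis unfolding z_def .
qed

text \<open>The least index has no predecessors. This is where \<open>1 \<le> k\<close> enters: without a transformed coordinate there is no
uncertainty principle.\<close>

lemma first_coords_nonempty:
  assumes "1 \<le> k"
  shows "(first_coords k :: 'd::{finite,linorder} set) \<noteq> {}"
proof -
  define m where "m = Min (UNIV :: 'd set)"
  have "m \<le> j" for j unfolding m_def by (rule Min_le) auto
  then have "\<not> j < m" for j by (simp add: not_less)
  then have "m \<in> first_coords k" using assms by (simp add: first_coords_def)
  then show ?thesis by blast
qed

lemma norm_phase_glue_ge:
  fixes K :: "'d::finite set"
  shows "(\<Sum>i\<in>K. (x i)\<^sup>2) + (\<Sum>i\<in>K. (\<omega> i)\<^sup>2) \<le> (norm (phase_glue K ((y, y'), (x, \<omega>))))\<^sup>2"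
proof -
  let ?z = "phase_glue K ((y, y'), (x, \<omega>))"
  have "(norm ?z)\<^sup>2 = (\<Sum>j\<in>UNIV. (?z $ j)\<^sup>2)"
    unfolding power2_norm_eq_inner inner_vec_def by (simp add: power2_eq_square)
  also have "\<dots> = (\<Sum>i\<in>UNIV. (?z $ Inl i)\<^sup>2) + (\<Sum>i\<in>UNIV. (?z $ Inr i)\<^sup>2)"
    unfolding UNIV_Plus_UNIV[symmetric] by (subst sum.Plus) auto
  also have "\<dots> \<ge> (\<Sum>i\<in>K. (?z $ Inl i)\<^sup>2) + (\<Sum>i\<in>K. (?z $ Inr i)\<^sup>2)"
    by (intro add_mono sum_mono2) auto
  finally show ?thesis by (simp add: phase_glue_def)
qed

text \<open>For almost all parameters \<open>y\<close>, \<open>y'\<close>, the uncertainty principle on \<open>\<real>\<^sup>K\<close> makes the slice of \<open>F\<close> at \<open>y\<close> or the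
slice of \<open>G\<close> at \<open>y'\<close> null. Since \<open>y\<close> and \<open>y'\<close> vary independently, all slices of \<open>F\<close> or all slices of \<open>G\<close> are null,
up to null sets of parameters.\<close>

theorem partial_stft_hardy:
  fixes F G :: "real ^ 'd::{finite,linorder} \<Rightarrow> complex" and \<alpha> C :: real
  assumes k: "1 \<le> k" and \<alpha>: "\<alpha> > 1" and C: "C \<ge> 0" and F: "F \<in> L2" and G: "G \<in> L2"
    and bound: "AE z in lebesgue. cmod (partial_stft k G F z) \<le> C * exp (- (pi * \<alpha> / 2) * (norm z)\<^sup>2)"
  shows "(AE x in lebesgue. F x = 0) \<or> (AE x in lebesgue. G x = 0)"
proof -
  define K where "K = (first_coords k :: 'd set)"
  have K: "finite K" "K \<noteq> {}" using first_coords_nonempty[OF k] by (auto simp: K_def)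
  have rep: "\<exists>f0. f0 \<in> borel_measurable borel \<and> (AE x in lborel. f x = f0 x) \<and> integrable lborel (\<lambda>x. (cmod (f0 x))\<^sup>2)"
    if "f \<in> L2" for f :: "real ^ 'd::{finite,linorder} \<Rightarrow> complex"
  proof -
    have f: "f \<in> borel_measurable lebesgue" "integrable lebesgue (\<lambda>x. (cmod (f x))\<^sup>2)"
      using that by (auto simp: L2_def)
    obtain f0 where f0: "f0 \<in> borel_measurable borel" "AE x in lborel. f x = f0 x"
      using borel_representative[OF f(1)] .
    have [measurable]: "f0 \<in> borel_measurable borel" by (rule f0)
    have "AE x in lebesgue. (cmod (f x))\<^sup>2 = (cmod (f0 x))\<^sup>2"
      using AE_completion[OF f0(2)] by eventually_elim simp
    then have "integrable lebesgue (\<lambda>x. (cmod (f0 x))\<^sup>2)"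
      using f by (subst integrable_cong_AE[symmetric]) (auto intro: measurable_completion)
    then have "integrable lborel (\<lambda>x. (cmod (f0 x))\<^sup>2)"
      by (subst (asm) integrable_completion) auto
    with f0 show ?thesis by blast
  qed
  obtain F0 where F0[measurable]: "F0 \<in> borel_measurable borel" and F_eq: "AE x in lborel. F x = F0 x"
    and F2: "integrable lborel (\<lambda>x. (cmod (F0 x))\<^sup>2)" using rep[OF F] by blast
  obtain G0 where G0[measurable]: "G0 \<in> borel_measurable borel" and G_eq: "AE x in lborel. G x = G0 x"
    and G2: "integrable lborel (\<lambda>x. (cmod (G0 x))\<^sup>2)" using rep[OF G] by blast
  have slice_meas: "(\<lambda>t. f (glue K t y)) \<in> borel_measurable (lborel_on K)"
    if "f \<in> borel_measurable borel" "y \<in> space (lborel_on (- K))" for f :: "real ^ 'd::{finite,linorder} \<Rightarrow> complex" and y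
    using measurable_compose[OF measurable_compose[OF measurable_Pair1'[OF that(2)] measurable_glue[of K]] that(1)] by simp
  have slice_int: "AE y in lborel_on (- K). integrable (lborel_on K) (\<lambda>t. (cmod (f (glue K t y)))\<^sup>2)"
    if [measurable]: "f \<in> borel_measurable borel" and f2: "integrable lborel (\<lambda>x. (cmod (f x))\<^sup>2)" for f :: "real ^ 'd::{finite,linorder} \<Rightarrow> complex"
  proof -
    interpret K: sigma_finite_measure "lborel_on K" by (intro lborel_on.sigma_finite) simp
    interpret N: sigma_finite_measure "lborel_on (- K)" by (intro lborel_on.sigma_finite) simp
    interpret pair_sigma_finite "lborel_on (- K)" "lborel_on K" by standard
    have "integrable (lborel_on (- K) \<Otimes>\<^sub>M lborel_on K) (\<lambda>z. (cmod (f (glue K (snd z) (fst z))))\<^sup>2)"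
      by (rule integrable_distr[OF measurable_glue]) (simp add: distr_glue f2)
    from AE_integrable_fst'[OF this] show ?thesis by simp
  qed
  have "AE z in lborel. cmod (partial_stft k G F z) \<le> C * exp (- (pi * \<alpha> / 2) * (norm z)\<^sup>2)"
    using bound unfolding AE_completion_iff .
  note slices = AE_phase_glueD[OF this, of K]
  have "AE y in lborel_on (- K). AE y' in lborel_on (- K).
      (AE t in lborel_on K. F0 (glue K t y) = 0) \<or> (AE t in lborel_on K. G0 (glue K t y') = 0)"
    using slices AE_glueD[OF F_eq, of K] slice_int[OF F0 F2] AE_space
  proof eventually_elim
    case (elim y)
    note y = elim
    from y(1) AE_glueD[OF G_eq, of K] slice_int[OF G0 G2] AE_space show ?case
    proof eventually_elim
      case (elim y')
      note y' = elim
      show ?case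
      proof (rule stft_hardy[OF K \<alpha> slice_meas[OF F0 y(4)] y(3) slice_meas[OF G0 y'(4)] y'(3)])
        from y'(1) show "AE x in lborel_on K. AE \<omega> in lborel_on K.
          cmod (fourier_on K (\<lambda>t. F0 (glue K t y) * cnj (G0 (glue K (\<lambda>j\<in>K. t j - x j) y'))) \<omega>)
            \<le> C * exp (- (pi * \<alpha> / 2) * ((\<Sum>j\<in>K. (x j)\<^sup>2) + (\<Sum>j\<in>K. (\<omega> j)\<^sup>2)))"
        proof eventually_elim
          case (elim x)
          then show ?case
          proof eventually_elim
            case (elim \<omega>)
            have "cmod (fourier_on K (\<lambda>t. F0 (glue K t y) * cnj (G0 (glue K (\<lambda>j\<in>K. t j - x j) y'))) \<omega>)
                = cmod (partial_stft k G F (phase_glue K ((y, y'), (x, \<omega>))))"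
              using y(2,4) y'(2,4) by (simp only: K_def partial_stft_phase_glue[OF F0 G0])
            also have "\<dots> \<le> C * exp (- (pi * \<alpha> / 2) * (norm (phase_glue K ((y, y'), (x, \<omega>))))\<^sup>2)" by (rule elim)
            also have "\<dots> \<le> C * exp (- (pi * \<alpha> / 2) * ((\<Sum>j\<in>K. (x j)\<^sup>2) + (\<Sum>j\<in>K. (\<omega> j)\<^sup>2)))"
              using norm_phase_glue_ge[of x K \<omega> y y'] \<alpha> C by (intro mult_left_mono) auto
            finally show ?case .
          qed
        qed
      qed
    qed
  qed
  then have "(AE y in lborel_on (- K). AE t in lborel_on K. F0 (glue K t y) = 0) \<or>
      (AE y' in lborel_on (- K). AE t in lborel_on K. G0 (glue K t y') = 0)"
    by (rule AE_disj_separate)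
  moreover have "AE x in lebesgue. f x = 0"
    if "AE y in lborel_on (- K). AE t in lborel_on K. f0 (glue K t y) = 0" "AE x in lborel. f x = f0 x"
      and [measurable]: "f0 \<in> borel_measurable borel" for f f0 :: "real ^ 'd::{finite,linorder} \<Rightarrow> complex"
  proof -
    have "AE x in lborel. f0 x = 0" by (rule AE_glueI[OF _ that(1)]) measurable
    with that(2) have "AE x in lborel. f x = 0" by eventually_elim simp
    then show ?thesis by (rule AE_completion)
  qed
  ultimately show ?thesis using F_eq G_eq F0 G0 by blast
qed

section \<open>Metaplectic time-frequency representations\<close>

lemma AE_lebesgue_linear_vimage:
  fixes A :: "real ^ 'n::finite ^ 'n"
  assumes A: "invertible A" and AE: "AE z in lebesgue. P (matrix_inv A *v z)"
  shows "AE z in lebesgue. P z"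
proof -
  have inv: "matrix_inv A ** A = mat 1"
    using someI_ex[OF A[unfolded invertible_def]] unfolding matrix_inv_def by blast
  have "negligible {z. \<not> P (matrix_inv A *v z)}"
    using AE unfolding negligible_iff_null_sets by (simp add: completion.AE_iff_null_sets)
  moreover have "{z. \<not> P z} \<subseteq> (\<lambda>z. matrix_inv A *v z) ` {z. \<not> P (matrix_inv A *v z)}"
  proof
    fix z assume "z \<in> {z. \<not> P z}"
    moreover have "matrix_inv A *v (A *v z) = z"
      using inv by (simp add: matrix_vector_mul_assoc)
    ultimately show "z \<in> (\<lambda>z. matrix_inv A *v z) ` {z. \<not> P (matrix_inv A *v z)}"
      by (intro image_eqI[of _ _ "A *v z"]) auto
  qed
  ultimately have "negligible {z. \<not> P z}"
    by (meson negligible_subset negligible_differentiable_image_negligible order_refl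
        linear_imp_differentiable_on matrix_vector_mul_linear)
  then show ?thesis
    unfolding negligible_iff_null_sets by (simp add: completion.AE_iff_null_sets)
qed

lemma unitary_op_AE_zeroD:
  assumes T: "unitary_op T" and f: "f \<in> L2" and 0: "AE x in lebesgue. T f x = 0"
  shows "AE x in lebesgue. f x = 0"
proof -
  have "L2_inner (T f) (T f) = 0"
    unfolding L2_inner_def using 0 by (intro integral_eq_zero_AE) (auto elim: eventually_mono)
  then have "L2_inner f f = 0" using T f unfolding unitary_op_def by metis
  moreover have "L2_inner f f = of_real (LINT x|lebesgue. (cmod (f x))\<^sup>2)"
    unfolding L2_inner_def complex_norm_square[symmetric] by (rule integral_complex_of_real)
  ultimately have "(LINT x|lebesgue. (cmod (f x))\<^sup>2) = 0" by simp
  moreover have "integrable lebesgue (\<lambda>x. (cmod (f x))\<^sup>2)" using f by (simp add: L2_def)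
  ultimately have "AE x in lebesgue. (cmod (f x))\<^sup>2 = 0"
    by (subst (asm) integral_nonneg_eq_0_iff_AE) auto
  then show ?thesis by eventually_elim simp
qed

theorem corollary4p5:
  fixes Q L \<Omega> :: "real ^ ('d::{finite,linorder} + 'd) ^ ('d + 'd)"
    and U :: "complex ^ ('d + 'd) ^ ('d + 'd)"
    and \<AA> :: "real ^ (('d + 'd) + ('d + 'd)) ^ (('d + 'd) + ('d + 'd))"
    and T :: "(real ^ ('d + 'd) \<Rightarrow> complex) \<Rightarrow> (real ^ ('d + 'd) \<Rightarrow> complex)"
    and f g :: "real ^ 'd::{finite,linorder} \<Rightarrow> complex"
    and c \<alpha> :: real
  assumes "transpose Q = Q" and "invertible L" and "unitary_matrix U"
    and "\<AA> = sympl_V Q ** sympl_D L ** sympl_R U"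
    and "metaplectic \<AA> T"
    and "\<not> block_diagonal (transpose U ** U)"
    and "invertible \<Omega>"
    and "\<exists>k \<A> \<B> T\<^sub>\<A> T\<^sub>\<B>. 1 \<le> k \<and> k \<le> CARD('d) \<and> symplectic \<A> \<and> symplectic \<B>
           \<and> metaplectic \<A> T\<^sub>\<A> \<and> metaplectic \<B> T\<^sub>\<B>
           \<and> (\<forall>u\<in>L2. \<forall>v\<in>L2. AE z in lebesgue.
                cmod (metaplectic_tfr T u v z)
                = cmod (dilation_op \<Omega> (partial_stft k (T\<^sub>\<B> v) (T\<^sub>\<A> u)) z))"
    and "f \<in> L2" and "g \<in> L2"
    and "c > 0" and "\<alpha> > 1"
    and "AE z in lebesgue.
           cmod (metaplectic_tfr T f g z) \<le> c * exp (- pi * \<alpha> * (norm (matrix_inv \<Omega> *v z))\<^sup>2 / 2)"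
  shows "(AE x in lebesgue. f x = 0) \<or> (AE x in lebesgue. g x = 0)"
proof -
  obtain k \<A> \<B> T\<^sub>\<A> T\<^sub>\<B> where k: "1 \<le> k" and A: "unitary_op T\<^sub>\<A>" and B: "unitary_op T\<^sub>\<B>"
    and fact: "\<forall>u\<in>L2. \<forall>v\<in>L2. AE z in lebesgue. cmod (metaplectic_tfr T u v z)
                = cmod (dilation_op \<Omega> (partial_stft k (T\<^sub>\<B> v) (T\<^sub>\<A> u)) z)"
    using assms(8) unfolding metaplectic_def by blast
  define s where "s = \<bar>det \<Omega>\<bar> powr (- 1 / 2)"
  have "det \<Omega> \<noteq> 0" using assms(7) by (simp add: invertible_det_nz)
  then have s: "s > 0" by (simp add: s_def)
  have "AE z in lebesgue. cmod (metaplectic_tfr T f g z)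
                = cmod (dilation_op \<Omega> (partial_stft k (T\<^sub>\<B> g) (T\<^sub>\<A> f)) z)"
    using fact assms(9,10) by blast
  with assms(13) have "AE z in lebesgue. cmod (partial_stft k (T\<^sub>\<B> g) (T\<^sub>\<A> f) (matrix_inv \<Omega> *v z))
      \<le> (c / s) * exp (- (pi * \<alpha> / 2) * (norm (matrix_inv \<Omega> *v z))\<^sup>2)"
  proof eventually_elim
    case (elim z)
    have "cmod (dilation_op \<Omega> (partial_stft k (T\<^sub>\<B> g) (T\<^sub>\<A> f)) z)
        = s * cmod (partial_stft k (T\<^sub>\<B> g) (T\<^sub>\<A> f) (matrix_inv \<Omega> *v z))"
      unfolding dilation_op_def s_def[symmetric] using s by (simp add: norm_mult)
    with elim s show ?case by (simp add: field_simps)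
  qed
  then have bound: "AE z in lebesgue. cmod (partial_stft k (T\<^sub>\<B> g) (T\<^sub>\<A> f) z) \<le> (c / s) * exp (- (pi * \<alpha> / 2) * (norm z)\<^sup>2)"
    by (rule AE_lebesgue_linear_vimage[OF assms(7)])
  have "T\<^sub>\<A> f \<in> L2" "T\<^sub>\<B> g \<in> L2" using A B assms(9,10) unfolding unitary_op_def by blast+
  then have "(AE x in lebesgue. T\<^sub>\<A> f x = 0) \<or> (AE x in lebesgue. T\<^sub>\<B> g x = 0)"
    using assms(11) s by (intro partial_stft_hardy[OF k assms(12) _ _ _ bound]) auto
  then show ?thesis
    using unitary_op_AE_zeroD[OF A assms(9)] unitary_op_AE_zeroD[OF B assms(10)] by blast
qed

end
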